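(* Let $\mathbb{P}$ be a translation-invariant Gibbs random field on $\mathbb{Z}^d$, $d\ge2$, with interaction $U$, which is non-uniformly exponentially $\varphi$-mixing. Then for all $q\in\mathbb{R}$ the limit $$\mathcal{W}(q)=\lim_{n\to\infty}\frac{1}{n^d}\log\int\mathbf{w}_n^{qd}\ d(\mathbb{P}\times\mathbb{P})$$ exists. Moreover, $$\mathcal{W}(q)=\begin{cases}P((1-q)U)+(q-1)P(U),&\text{for }q\ge-1,\\ P(2U)-2P(U),&\text{for }q<-1.\end{cases}$$
   Context: Setting. $\mathcal{A}$ is a finite set, $\Omega=\mathcal{A}^{\mathbb{Z}^d}$ with the product topology and its Borel sigma-field, $\mathcal{S}$ is the set of (nonempty) finite subsets of $\mathbb{Z}^d$, $|\mathbf{x}|=\sum_i|x_i|$, $d(A,B)=\min\{|\mathbf{x}-\mathbf{y}|:\mathbf{x}\in A,\mathbf{y}\in B\}$ for $A,B\in\mathcal{S}$. $\sigma_V$ is the restriction of $\sigma$ to $V$, $\Omega_V=\mathcal{A}^V$, $\mathcal{F}_V$ is the sigma-field generated by $\sigma(\mathbf{x})$, $\mathbf{x}\in V$, $(\tau_{\mathbf{x}}\sigma)(\mathbf{y})=\sigma(\mathbf{x}+\mathbf{y})$, and $C_n=[0,n]^d\cap\mathbb{Z}^d$. Waiting time: for $\xi,\sigma\in\Omega$, $\mathbf{w}_n(\xi,\sigma)$ is the minimal $k\in\mathbb{N}$ such that there is $\mathbf{x}\in\mathbb{Z}_+^d$ with $|\mathbf{x}|>0$, $0\le x_i\le k$ for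 all $i$, and $(\tau_{\mathbf{x}}\sigma)_{C_n}=\xi_{C_n}$. Here $(\xi,\sigma)$ is distributed according to $\mathbb{P}\times\mathbb{P}$. Gibbs fields. A translation-invariant interaction is $U:\mathcal{S}\times\Omega\to\mathbb{R}$ such that $U(A,\sigma)$ depends only on $\sigma_A$, $U(A+\mathbf{x},\tau_{-\mathbf{x}}\sigma)=U(A,\sigma)$, and $\sum_{A\ni 0}\sup_\sigma|U(A,\sigma)|<\infty$. Put $H^\zeta_\Lambda(\sigma)=\sum_{A\cap\Lambda\ne\emptyset}U(A,\sigma_\Lambda\zeta_{\Lambda^c})$. A translation-invariant Gibbs random field with interaction $U$ is a translation-invariant probability measure $\mathbb{P}$ on $\Omega$ such that for every $\Lambda\in\mathcal{S}$ the conditional distribution of $\sigma_\Lambda$ given $\sigma_{\Lambda^c}=\zeta_{\Lambda^c}$ is, for $\mathbb{P}$-a.e. $\zeta$, proportional to $e^{-H^\zeta_\Lambda(\sigma)}$. Pressure. $P(U)=\lim_{n\to\infty}\frac{1}{n^d}\log\sum_{\sigma_{C_n}\in\Omega_{C_n}}\exp\left(-\sum_{A\subset C_n}U(A,\sigma)\right)$. Mixing. For $m>0$, $\varphi(m)=\sup\frac{1}{|A_1|}\left|\mathbb{P}(E_{A_1}\mid E_{A_2})-\mathbb{P}(E_{A_1})\right|$, the supremum over finite $A_1,A_2\subset\mathbb{Z}^d$ with $d(A_1,A_2)\ge m$ and $E_{A_i}\in\mathcal{F}_{A_i}$ with $\mathbb{P}(E_{A_2})>0$. $\mathbb{P}$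 is non-uniformly exponentially $\varphi$-mixing if there are $C_1,C_2>0$ with $\varphi(m)\le C_1e^{-C_2m}$ for all $m>0$. *)

theory Defs
  imports "HOL-Probability.Probability"
begin

text \<open>The lattice \<open>\<int>\<^sup>d\<close> is \<open>int ^ 'd\<close> with \<open>d = CARD('d)\<close>; the finite alphabet is the type \<open>'a\<close>.\<close>

type_synonym ('a, 'd) config = "int ^ 'd \<Rightarrow> 'a"

definition finite_regions :: "(int ^ 'd::finite) set set" where
  "finite_regions = {A. finite A \<and> A \<noteq> {}}"

definition l1norm :: "int ^ 'd::finite \<Rightarrow> int" where
  "l1norm x = (\<Sum>i\<in>UNIV. \<bar>x $ i\<bar>)"

definition region_dist :: "(int ^ 'd::finite) set \<Rightarrow> (int ^ 'd) set \<Rightarrow> int" where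
  "region_dist A B = Min {l1norm (x - y) | x y. x \<in> A \<and> y \<in> B}"

definition shift :: "int ^ 'd::finite \<Rightarrow> ('a, 'd) config \<Rightarrow> ('a, 'd) config" where
  "shift x \<sigma> = (\<lambda>y. \<sigma> (x + y))"

definition cube :: "nat \<Rightarrow> (int ^ 'd::finite) set" where
  "cube n = {x. \<forall>i. 0 \<le> x $ i \<and> x $ i \<le> int n}"

text \<open>The index set is countable and the alphabet finite and discrete, so the product
  sigma-field is the Borel sigma-field of the product topology.\<close>

definition config_space :: "('a, 'd::finite) config measure" where
  "config_space = Pi\<^sub>M UNIV (\<lambda>_. count_space UNIV)"

definition local_field :: "(int ^ 'd::finite) set \<Rightarrow> ('a, 'd) config measure" where
  "local_field V = sigma UNIV {{\<sigma>. \<sigma> x = a} | x a. x \<in> V}"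

definition translation_invariant_prob :: "('a, 'd::finite) config measure \<Rightarrow> bool" where
  "translation_invariant_prob P \<longleftrightarrow>
     prob_space P \<and> sets P = sets config_space \<and> (\<forall>x. distr P P (shift x) = P)"

text \<open>The value is \<open>\<infinity>\<close> if the pattern never occurs.\<close>

definition waiting_time :: "nat \<Rightarrow> ('a, 'd::finite) config \<Rightarrow> ('a, 'd) config \<Rightarrow> enat" where
  "waiting_time n \<xi> \<sigma> =
     Inf (enat ` {k. \<exists>x. l1norm x > 0 \<and> (\<forall>i. 0 \<le> x $ i \<and> x $ i \<le> int k) \<and>
                      restrict (shift x \<sigma>) (cube n) = restrict \<xi> (cube n)})"

definition enat_powr :: "enat \<Rightarrow> real \<Rightarrow> ennreal" where
  "enat_powr w r = (case w of
       enat k \<Rightarrow> ennreal (real k powr r)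
     | \<infinity> \<Rightarrow> (if r < 0 then 0 else if r = 0 then 1 else \<infinity>))"

definition ln_ennreal :: "ennreal \<Rightarrow> ereal" where
  "ln_ennreal x = (if x = 0 then - \<infinity> else if x = \<infinity> then \<infinity> else ereal (ln (enn2real x)))"

type_synonym ('a, 'd) interaction = "(int ^ 'd) set \<Rightarrow> ('a, 'd) config \<Rightarrow> real"

definition translation_invariant_interaction :: "('a::finite, 'd::finite) interaction \<Rightarrow> bool" where
  "translation_invariant_interaction U \<longleftrightarrow>
     (\<forall>A\<in>finite_regions. \<forall>\<sigma> \<sigma>'. restrict \<sigma> A = restrict \<sigma>' A \<longrightarrow> U A \<sigma> = U A \<sigma>') \<and>
     (\<forall>A\<in>finite_regions. \<forall>x \<sigma>. U ((\<lambda>y. y + x) ` A) (shift (- x) \<sigma>) = U A \<sigma>) \<and>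
     (\<lambda>A. SUP \<sigma>. \<bar>U A \<sigma>\<bar>) summable_on {A \<in> finite_regions. 0 \<in> A}"

text \<open>\<open>override_on \<zeta> \<sigma> \<Lambda>\<close> is \<open>\<sigma>\<close> on \<open>\<Lambda>\<close> and \<open>\<zeta>\<close> off \<open>\<Lambda>\<close>.\<close>

definition hamiltonian ::
    "('a, 'd::finite) interaction \<Rightarrow> (int ^ 'd) set \<Rightarrow> ('a, 'd) config \<Rightarrow> ('a, 'd) config \<Rightarrow> real" where
  "hamiltonian U \<Lambda> \<zeta> \<sigma> =
     (\<Sum>\<^sub>\<infinity>A \<in> {A \<in> finite_regions. A \<inter> \<Lambda> \<noteq> {}}. U A (override_on \<zeta> \<sigma> \<Lambda>))"

text \<open>In the last conjunct, the left-hand side is the conditional probability of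
  \<open>\<sigma>\<^sub>\<Lambda> = \<eta>\<close> given the configuration outside \<open>\<Lambda>\<close>.\<close>

definition translation_invariant_gibbs_field ::
    "('a::finite, 'd::finite) interaction \<Rightarrow> ('a, 'd::finite) config measure \<Rightarrow> bool" where
  "translation_invariant_gibbs_field U P \<longleftrightarrow>
     translation_invariant_prob P \<and>
     (\<forall>\<Lambda>\<in>finite_regions. AE \<zeta> in P. \<forall>\<eta> \<in> \<Lambda> \<rightarrow>\<^sub>E UNIV.
        real_cond_exp P (local_field (- \<Lambda>)) (indicator {\<sigma>. restrict \<sigma> \<Lambda> = \<eta>}) \<zeta> =
          exp (- hamiltonian U \<Lambda> \<zeta> \<eta>) /
            (\<Sum>\<eta>' \<in> \<Lambda> \<rightarrow>\<^sub>E UNIV. exp (- hamiltonian U \<Lambda> \<zeta> \<eta>')))"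

text \<open>The elements of \<open>cube n \<rightarrow>\<^sub>E UNIV\<close> represent the patterns on the cube; their values
  outside the cube are irrelevant, since \<open>U A\<close> depends only on the restriction to \<open>A\<close>.\<close>

definition pressure :: "('a::finite, 'd::finite) interaction \<Rightarrow> real" where
  "pressure U =
     lim (\<lambda>n. 1 / real n ^ CARD('d) *
       ln (\<Sum>\<sigma> \<in> cube n \<rightarrow>\<^sub>E UNIV.
             exp (- (\<Sum>A \<in> {A \<in> finite_regions. A \<subseteq> cube n}. U A \<sigma>))))"

definition phi_mix :: "('a, 'd::finite) config measure \<Rightarrow> real \<Rightarrow> real" where
  "phi_mix P m =
     Sup {1 / real (card A1) *
            \<bar>cond_prob P (\<lambda>\<sigma>. \<sigma> \<in> E1) (\<lambda>\<sigma>. \<sigma> \<in> E2) - measure P E1\<bar>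
          | A1 A2 E1 E2.
            A1 \<in> finite_regions \<and> A2 \<in> finite_regions \<and> m \<le> real_of_int (region_dist A1 A2) \<and>
            E1 \<in> sets (local_field A1) \<and> E2 \<in> sets (local_field A2) \<and> measure P E2 > 0}"

definition nonuniformly_exp_phi_mixing :: "('a, 'd::finite) config measure \<Rightarrow> bool" where
  "nonuniformly_exp_phi_mixing P \<longleftrightarrow>
     (\<exists>C1>0. \<exists>C2>0. \<forall>m>0. phi_mix P m \<le> C1 * exp (- C2 * m))"

end

theory Submission
  imports Defs "HOL-Real_Asymp.Real_Asymp"
begin

text \<open>All estimates are needed only up to factors \<open>exp (o(n\<^sup>d))\<close>. Summability of the
  interaction gives \<open>P(\<sigma> = \<eta> on C\<^sub>n) = exp (o(n\<^sup>d) - E(\<eta>)) / Z\<^sub>n\<close>, where \<open>E\<close> is the energy with free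
  boundary and \<open>Z\<^sub>n\<close> its partition function. For a pattern of probability \<open>p\<close> the union bound
  gives \<open>P(w \<le> k) \<le> (k + 1)\<^sup>d p\<close>. Conversely, on a sublattice whose spacing \<open>L\<close> is of order
  \<open>n\<^sup>d\<close> the mixing error is at most \<open>p / 2\<close>, so that \<open>P(w > L k) \<le> exp (- p k\<^sup>d / 2)\<close>.
  Hence the moment of order \<open>q d\<close> of \<open>w\<close> is \<open>p powr (- q)\<close> up to subexponential factors
  if \<open>q \<ge> -1\<close>; for \<open>q < -1\<close> it is dominated by the event \<open>w = 1\<close>, of probability about \<open>p\<close>.
  Summing over patterns yields the partition function of \<open>(1 - q) U\<close>, respectively \<open>2 U\<close>.\<close>

section \<open>Summable interactions\<close>

text \<open>The mixing error is additive, not relative to the probability of the pattern, and that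
  probability can be exponentially small in the volume. This is why the separation of the copies has
  to grow with the volume; since the spacing enters a moment only through a power, the price is
  polynomial. The error also carries the factor \<open>card A1\<close>, so mixing is applied
  asymmetrically: \<open>A1\<close> is always a single translate of the cube, while all remaining
  translates go into \<open>A2\<close>, whose size costs nothing. The threshold q = -1 comes from
  the layers where w is of order t. Such a layer contributes about t^(q d) * t^d * p. For q > -1 the
  largest relevant t, about p^(-1/d), dominates; for q < -1 the layer t = 1 does; at q = -1 all
  layers are comparable, and their number is logarithmic in 1/p, hence at most linear in the volume.
  As the pattern and the field in which it is sought are independent, self-overlapping patterns need
  no separate treatment. Convergence of the normalised logarithms is part of the work, because
  \<open>pressure\<close> is a bare \<open>lim\<close>.\<close>

lemma infsum_UN_le:
  fixes f :: "'b \<Rightarrow> real"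
  assumes "finite X" "\<And>x. x \<in> X \<Longrightarrow> f summable_on S x" "\<And>x y. x \<in> X \<Longrightarrow> y \<in> S x \<Longrightarrow> 0 \<le> f y"
  shows "f summable_on (\<Union>x\<in>X. S x) \<and> infsum f (\<Union>x\<in>X. S x) \<le> (\<Sum>x\<in>X. infsum f (S x))"
  using assms
proof (induction X)
  case empty
  then show ?case by simp
next
  case (insert x X)
  let ?T = "\<Union>x\<in>X. S x"
  have T: "f summable_on ?T" "infsum f ?T \<le> (\<Sum>x\<in>X. infsum f (S x))"
    using insert by auto
  have D: "f summable_on (?T - S x)"
    by (rule summable_on_subset_banach[OF T(1)]) auto
  \<comment> \<open>The sets may overlap, so only the part of the union outside \<open>S x\<close>
    is added; nonnegativity turns the resulting equation into subadditivity.\<close>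
  have eq: "(\<Union>x\<in>insert x X. S x) = S x \<union> (?T - S x)" by auto
  have "infsum f (?T - S x) \<le> infsum f ?T"
    using insert by (intro infsum_mono2[OF D T(1)]) auto
  moreover have "infsum f (S x \<union> (?T - S x)) = infsum f (S x) + infsum f (?T - S x)"
    by (rule infsum_Un_disjoint) (use insert D in auto)
  moreover have "f summable_on (S x \<union> (?T - S x))"
    by (rule summable_on_Un_disjoint) (use insert D in auto)
  ultimately show ?case
    unfolding eq using insert.hyps T(2) by simp
qed

definition interaction_norm :: "('a, 'd::finite) interaction \<Rightarrow> (int ^ 'd) set \<Rightarrow> real" where
  "interaction_norm U A = (SUP \<sigma>. \<bar>U A \<sigma>\<bar>)"

definition site_norm :: "('a, 'd::finite) interaction \<Rightarrow> real" where
  "site_norm U = (\<Sum>\<^sub>\<infinity>A\<in>{A \<in> finite_regions. 0 \<in> A}. interaction_norm U A)"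

text \<open>The common error term: it bounds both the effect of any boundary condition on the energy
  in \<open>\<Lambda>\<close> and the coupling between \<open>\<Lambda>\<close> and a disjoint
  region.\<close>

definition boundary_norm :: "('a, 'd::finite) interaction \<Rightarrow> (int ^ 'd) set \<Rightarrow> real" where
  "boundary_norm U \<Lambda> =
     (\<Sum>\<^sub>\<infinity>A\<in>{A \<in> finite_regions. A \<inter> \<Lambda> \<noteq> {} \<and> \<not> A \<subseteq> \<Lambda>}. interaction_norm U A)"

section \<open>Boxes in the lattice\<close>

definition int_box :: "int \<Rightarrow> int \<Rightarrow> (int ^ 'd::finite) set" where
  "int_box a b = {x. \<forall>i. a \<le> x $ i \<and> x $ i \<le> b}"

lemma cube_eq_int_box: "cube n = int_box 0 (int n)"
  by (simp add: cube_def int_box_def)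

lemma bij_betw_int_box: "bij_betw vec_nth (int_box a b :: (int ^ 'd::finite) set) (UNIV \<rightarrow>\<^sub>E {a..b})"
  by (rule bij_betwI[where g = vec_lambda]) (auto simp: int_box_def)

lemma finite_int_box [simp]: "finite (int_box a b :: (int ^ 'd::finite) set)"
  using bij_betw_finite[OF bij_betw_int_box[of a b, where 'd = 'd]] by (simp add: finite_PiE)

lemma card_int_box: "card (int_box a b :: (int ^ 'd::finite) set) = nat (b - a + 1) ^ CARD('d)"
proof -
  have "card (int_box a b :: (int ^ 'd::finite) set) = card ((UNIV :: 'd set) \<rightarrow>\<^sub>E {a..b})"
    by (rule bij_betw_same_card[OF bij_betw_int_box])
  then show ?thesis by (simp add: card_PiE)
qed

lemma finite_cube [simp]: "finite (cube n)"
  by (simp add: cube_eq_int_box)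

lemma card_cube: "card (cube n :: (int ^ 'd::finite) set) = (n + 1) ^ CARD('d)"
  by (simp add: cube_eq_int_box card_int_box nat_add_distrib)

lemma zero_in_cube [simp]: "0 \<in> cube n"
  by (simp add: cube_def)

lemma cube_in_finite_regions [simp]: "cube n \<in> finite_regions"
  unfolding finite_regions_def using zero_in_cube finite_cube by blast

lemma finite_subset_int_box:
  fixes A :: "(int ^ 'd::finite) set"
  assumes "finite A"
  obtains R :: nat where "A \<subseteq> int_box (- int R) (int R)"
proof -
  have "\<bar>x $ i\<bar> \<le> int (nat (\<Sum>x\<in>A. \<Sum>i\<in>UNIV. \<bar>x $ i\<bar>))" if "x \<in> A" for x i
  proof -
    have "\<bar>x $ i\<bar> \<le> (\<Sum>i\<in>UNIV. \<bar>x $ i\<bar>)"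
      by (rule member_le_sum) auto
    also have "\<dots> \<le> (\<Sum>x\<in>A. \<Sum>i\<in>UNIV. \<bar>x $ i\<bar>)"
      by (rule member_le_sum[OF that]) (auto simp: assms sum_nonneg)
    finally show ?thesis by linarith
  qed
  then show ?thesis
    by (intro that[of "nat (\<Sum>x\<in>A. \<Sum>i\<in>UNIV. \<bar>x $ i\<bar>)"])
       (auto simp only: int_box_def abs_le_iff mem_Collect_eq minus_le_iff)
qed

lemma finite_regions_translate [simp]:
  "(\<lambda>y. y + x) ` A \<in> finite_regions \<longleftrightarrow> A \<in> finite_regions" for x :: "int ^ 'd::finite"
  by (auto simp: finite_regions_def finite_image_iff inj_on_def)

lemma surj_shift: "surj (shift x)"
  by (rule surjI[where f = "shift (- x)"]) (simp add: shift_def)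

locale summable_interaction =
  fixes U :: "('a::finite, 'd::finite) interaction"
  assumes inv: "translation_invariant_interaction U"
begin

lemma local: "A \<in> finite_regions \<Longrightarrow> restrict \<sigma> A = restrict \<sigma>' A \<Longrightarrow> U A \<sigma> = U A \<sigma>'"
  using inv unfolding translation_invariant_interaction_def by blast

lemma translate: "A \<in> finite_regions \<Longrightarrow> U ((\<lambda>y. y + x) ` A) (shift (- x) \<sigma>) = U A \<sigma>"
  using inv unfolding translation_invariant_interaction_def by blast

lemma summable_at_0: "interaction_norm U summable_on {A \<in> finite_regions. 0 \<in> A}"
  using inv unfolding translation_invariant_interaction_def interaction_norm_def by blast

text \<open>The real supremum is meaningful only for bounded sets. Here the range is even finite,
  because \<open>U A\<close> sees finitely many sites with finitely many letters each.\<close>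

lemma le_interaction_norm:
  assumes "A \<in> finite_regions"
  shows "\<bar>U A \<sigma>\<bar> \<le> interaction_norm U A"
proof -
  have "finite (A \<rightarrow>\<^sub>E (UNIV :: 'a set))"
    using assms by (auto simp: finite_regions_def intro!: finite_PiE)
  moreover have "range (\<lambda>\<sigma>. \<bar>U A \<sigma>\<bar>) \<subseteq> (\<lambda>\<sigma>. \<bar>U A \<sigma>\<bar>) ` (A \<rightarrow>\<^sub>E (UNIV :: 'a set))"
  proof
    fix y assume "y \<in> range (\<lambda>\<sigma>. \<bar>U A \<sigma>\<bar>)"
    then obtain \<sigma> where y: "y = \<bar>U A \<sigma>\<bar>" by auto
    have "U A \<sigma> = U A (restrict \<sigma> A)"
      by (rule local[OF assms]) simp
    with y show "y \<in> (\<lambda>\<sigma>. \<bar>U A \<sigma>\<bar>) ` (A \<rightarrow>\<^sub>E (UNIV :: 'a set))"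
      by (intro image_eqI[where x = "restrict \<sigma> A"]) auto
  qed
  ultimately have "finite (range (\<lambda>\<sigma>. \<bar>U A \<sigma>\<bar>))"
    by (meson finite_imageI finite_subset)
  then show ?thesis
    unfolding interaction_norm_def by (intro cSUP_upper) auto
qed

lemma interaction_norm_nonneg: "A \<in> finite_regions \<Longrightarrow> 0 \<le> interaction_norm U A"
  using le_interaction_norm[of A undefined] by linarith

lemma interaction_norm_translate:
  assumes "A \<in> finite_regions"
  shows "interaction_norm U ((\<lambda>y. y + x) ` A) = interaction_norm U A"
proof -
  have "range (\<lambda>\<sigma>. \<bar>U ((\<lambda>y. y + x) ` A) \<sigma>\<bar>) =
        (\<lambda>\<sigma>. \<bar>U ((\<lambda>y. y + x) ` A) \<sigma>\<bar>) ` range (shift (- x))"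
    by (simp add: surj_shift)
  also have "\<dots> = range (\<lambda>\<sigma>. \<bar>U A \<sigma>\<bar>)"
    by (simp add: image_image translate[OF assms])
  finally show ?thesis
    by (simp add: interaction_norm_def)
qed

lemma infsum_translate:
  assumes "S \<subseteq> finite_regions"
  shows "interaction_norm U summable_on ((`) (\<lambda>y. y + x)) ` S \<longleftrightarrow> interaction_norm U summable_on S"
    and "infsum (interaction_norm U) (((`) (\<lambda>y. y + x)) ` S) = infsum (interaction_norm U) S"
proof -
  have inj: "inj_on ((`) (\<lambda>y. y + x)) S"
    by (intro inj_onI) (metis (no_types, lifting) add_right_cancel inj_image_eq_iff inj_onI)
  have *: "interaction_norm U ((\<lambda>y. y + x) ` A) = interaction_norm U A" if "A \<in> S" for A
    using that assms by (intro interaction_norm_translate) auto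
  show "interaction_norm U summable_on ((`) (\<lambda>y. y + x)) ` S \<longleftrightarrow> interaction_norm U summable_on S"
    using summable_on_reindex[OF inj, of "interaction_norm U"] * by (simp add: o_def cong: summable_on_cong)
  show "infsum (interaction_norm U) (((`) (\<lambda>y. y + x)) ` S) = infsum (interaction_norm U) S"
    using infsum_reindex[OF inj, of "interaction_norm U"] * by (simp add: o_def cong: infsum_cong)
qed

lemma translate_regions_eq:
  "((`) (\<lambda>y. y + x)) ` {A \<in> finite_regions. 0 \<in> A} = {A \<in> finite_regions. x \<in> A}" for x :: "int ^ 'd"
proof (intro set_eqI iffI)
  fix A assume A: "A \<in> {A \<in> finite_regions. x \<in> A}"
  have "A = (\<lambda>y. y + x) ` (\<lambda>y. y + (- x)) ` A"
    by (simp add: image_image)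
  moreover have "0 \<in> (\<lambda>y. y + (- x)) ` A" "(\<lambda>y. y + (- x)) ` A \<in> finite_regions"
    using A by (force, simp only: finite_regions_translate, simp)
  ultimately show "A \<in> ((`) (\<lambda>y. y + x)) ` {A \<in> finite_regions. 0 \<in> A}"
    by blast
qed auto

lemma site_norm_nonneg: "0 \<le> site_norm U"
  unfolding site_norm_def by (intro infsum_nonneg) (auto simp: interaction_norm_nonneg)

lemma summable_at: "interaction_norm U summable_on {A \<in> finite_regions. x \<in> A}"
  by (subst translate_regions_eq[symmetric], subst infsum_translate) (auto simp: summable_at_0)

lemma infsum_at: "infsum (interaction_norm U) {A \<in> finite_regions. x \<in> A} = site_norm U"
  by (subst translate_regions_eq[symmetric], subst infsum_translate) (auto simp: site_norm_def)

text \<open>A region that meets \<open>\<Lambda>\<close> contains one of its sites; counting it once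
  for each such site only overestimates, since all terms are nonnegative.\<close>

lemma summable_touching:
  assumes "finite \<Lambda>"
  shows "interaction_norm U summable_on {A \<in> finite_regions. A \<inter> \<Lambda> \<noteq> {}}"
    and "infsum (interaction_norm U) {A \<in> finite_regions. A \<inter> \<Lambda> \<noteq> {}} \<le> real (card \<Lambda>) * site_norm U"
proof -
  have eq: "{A \<in> finite_regions. A \<inter> \<Lambda> \<noteq> {}} = (\<Union>x\<in>\<Lambda>. {A \<in> finite_regions. x \<in> A})"
    by auto
  have "interaction_norm U summable_on (\<Union>x\<in>\<Lambda>. {A \<in> finite_regions. x \<in> A}) \<and>
    infsum (interaction_norm U) (\<Union>x\<in>\<Lambda>. {A \<in> finite_regions. x \<in> A}) \<le> (\<Sum>x\<in>\<Lambda>. infsum (interaction_norm U) {A \<in> finite_regions. x \<in> A})"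
    by (rule infsum_UN_le[OF assms summable_at]) (auto simp: interaction_norm_nonneg)
  then show "interaction_norm U summable_on {A \<in> finite_regions. A \<inter> \<Lambda> \<noteq> {}}"
    and "infsum (interaction_norm U) {A \<in> finite_regions. A \<inter> \<Lambda> \<noteq> {}} \<le> real (card \<Lambda>) * site_norm U"
    by (simp_all add: eq infsum_at)
qed

lemma summable_boundary:
  assumes "finite \<Lambda>"
  shows "interaction_norm U summable_on {A \<in> finite_regions. A \<inter> \<Lambda> \<noteq> {} \<and> \<not> A \<subseteq> \<Lambda>}"
  by (rule summable_on_subset_banach[OF summable_touching(1)[OF assms]]) auto

lemma boundary_norm_nonneg: "0 \<le> boundary_norm U \<Lambda>"
  unfolding boundary_norm_def by (intro infsum_nonneg) (auto simp: interaction_norm_nonneg)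

lemma boundary_norm_le_card:
  assumes "finite \<Lambda>"
  shows "boundary_norm U \<Lambda> \<le> real (card \<Lambda>) * site_norm U"
proof -
  have "boundary_norm U \<Lambda> \<le> infsum (interaction_norm U) {A \<in> finite_regions. A \<inter> \<Lambda> \<noteq> {}}"
    unfolding boundary_norm_def
    by (rule infsum_mono2[OF summable_boundary[OF assms] summable_touching(1)[OF assms]])
       (auto simp: interaction_norm_nonneg)
  with summable_touching(2)[OF assms] show ?thesis by linarith
qed

lemma boundary_norm_translate: "boundary_norm U ((\<lambda>y. y + x) ` \<Lambda>) = boundary_norm U \<Lambda>"
proof -
  have "{A \<in> finite_regions. A \<inter> (\<lambda>y. y + x) ` \<Lambda> \<noteq> {} \<and> \<not> A \<subseteq> (\<lambda>y. y + x) ` \<Lambda>} =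
    ((`) (\<lambda>y. y + x)) ` {A \<in> finite_regions. A \<inter> \<Lambda> \<noteq> {} \<and> \<not> A \<subseteq> \<Lambda>}" (is "?L = ?R")
  proof (intro set_eqI iffI)
    fix A assume A: "A \<in> ?L"
    have eq: "A = (\<lambda>y. y + x) ` (\<lambda>y. y + (- x)) ` A"
      by (simp add: image_image)
    have inj: "inj (\<lambda>y. y + x)" by (simp add: inj_on_def)
    have "(\<lambda>y. y + (- x)) ` A \<inter> \<Lambda> \<noteq> {} \<and> \<not> (\<lambda>y. y + (- x)) ` A \<subseteq> \<Lambda>"
      using A by (fastforce simp: image_iff)
    moreover have "(\<lambda>y. y + (- x)) ` A \<in> finite_regions"
      using A by (simp only: finite_regions_translate, simp)
    ultimately show "A \<in> ?R" using eq by blast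
  next
    fix A assume "A \<in> ?R"
    then show "A \<in> ?L" by (auto simp: image_iff)
  qed
  then show ?thesis
    unfolding boundary_norm_def by (simp only:) (rule infsum_translate(2), auto)
qed

section \<open>Boundary effects are of lower order on large cubes\<close>

lemma tail_small:
  assumes "\<epsilon> > 0"
  obtains R :: nat where
    "infsum (interaction_norm U) {A \<in> finite_regions. 0 \<in> A \<and> \<not> A \<subseteq> int_box (- int R) (int R)} \<le> \<epsilon>"
proof -
  let ?S = "{A \<in> finite_regions. (0 :: int ^ 'd) \<in> A}"
  obtain F where F: "finite F" "F \<subseteq> ?S" "dist (sum (interaction_norm U) F) (site_norm U) \<le> \<epsilon>"
    using infsum_finite_approximation[OF summable_at_0 assms] unfolding site_norm_def by blast
  have "finite (\<Union>F)" using F by (auto simp: finite_regions_def)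
  then obtain R where R: "\<Union>F \<subseteq> int_box (- int R) (int R)"
    by (rule finite_subset_int_box)
  let ?T = "{A \<in> finite_regions. (0 :: int ^ 'd) \<in> A \<and> \<not> A \<subseteq> int_box (- int R) (int R)}"
  have s: "interaction_norm U summable_on ?T" "interaction_norm U summable_on (?S - F)"
    by (rule summable_on_subset_banach[OF summable_at_0]; auto)+
  \<comment> \<open>All members of \<open>F\<close> lie in the box, so a region that leaves the box
    is not in \<open>F\<close>.\<close>
  have "infsum (interaction_norm U) ?T \<le> infsum (interaction_norm U) (?S - F)"
    by (rule infsum_mono2[OF s]) (use R in \<open>auto simp: interaction_norm_nonneg\<close>)
  also have "\<dots> = site_norm U - sum (interaction_norm U) F"
    using infsum_Diff[OF summable_at_0, of F] F by (simp add: site_norm_def)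
  also have "\<dots> \<le> \<epsilon>"
    using F(3) by (simp add: dist_real_def)
  finally show ?thesis by (rule that)
qed

text \<open>A site at depth \<open>R\<close> inside the cube sees the complement only through
  regions that reach farther than \<open>R\<close> from it; translation moves the site to the
  origin.\<close>

lemma infsum_at_boundary_le:
  assumes "x \<in> int_box (int R) (int n - int R)"
  shows "infsum (interaction_norm U) {A \<in> finite_regions. x \<in> A \<and> \<not> A \<subseteq> cube n} \<le>
    infsum (interaction_norm U) {A \<in> finite_regions. 0 \<in> A \<and> \<not> A \<subseteq> int_box (- int R) (int R)}"
proof -
  let ?T = "{A \<in> finite_regions. (0 :: int ^ 'd) \<in> A \<and> \<not> A \<subseteq> int_box (- int R) (int R)}"
  let ?L = "{A \<in> finite_regions. x \<in> A \<and> \<not> A \<subseteq> cube n}"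
  have "?L \<subseteq> ((`) (\<lambda>y. y + x)) ` ?T"
  proof
    fix A assume A: "A \<in> ?L"
    have eq: "A = (\<lambda>y. y + x) ` (\<lambda>y. y + (- x)) ` A"
      by (simp add: image_image)
    obtain y where y: "y \<in> A" "y \<notin> cube n" using A by auto
    then obtain i where i: "y $ i < 0 \<or> y $ i > int n" by (auto simp: cube_def not_le)
    have "int R \<le> x $ i \<and> x $ i \<le> int n - int R" using assms by (auto simp: int_box_def)
    with i have "(y + (- x)) $ i < - int R \<or> (y + (- x)) $ i > int R" by auto
    then have "y + (- x) \<notin> int_box (- int R) (int R)"
      unfolding int_box_def by (metis (mono_tags, lifting) mem_Collect_eq not_le)
    with y have "\<not> (\<lambda>y. y + (- x)) ` A \<subseteq> int_box (- int R) (int R)" by blast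
    moreover have "0 \<in> (\<lambda>y. y + (- x)) ` A" using A by force
    moreover have "(\<lambda>y. y + (- x)) ` A \<in> finite_regions"
      using A by (simp only: finite_regions_translate, simp)
    ultimately show "A \<in> ((`) (\<lambda>y. y + x)) ` ?T" using eq by blast
  qed
  moreover have "interaction_norm U summable_on ((`) (\<lambda>y. y + x)) ` ?T"
    by (subst infsum_translate) (auto intro: summable_on_subset_banach[OF summable_at_0])
  moreover have "interaction_norm U summable_on ?L"
    by (rule summable_on_subset_banach[OF summable_at[of x]]) auto
  ultimately have "infsum (interaction_norm U) ?L \<le> infsum (interaction_norm U) (((`) (\<lambda>y. y + x)) ` ?T)"
    by (intro infsum_mono2) (auto intro!: interaction_norm_nonneg)
  also have "\<dots> = infsum (interaction_norm U) ?T"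
    by (rule infsum_translate) auto
  finally show ?thesis .
qed

text \<open>Each crossing region is charged to its sites in the cube. Sites at depth
  \<open>R\<close> pay only the tail of the interaction, and the sites of the outer shell pay at
  most the full \<open>site_norm U\<close>. The inner box has \<open>n + 1 - 2 * R\<close> sites per
  side.\<close>

lemma boundary_norm_cube_le:
  assumes "2 * R \<le> n"
  shows "boundary_norm U (cube n) \<le>
    real ((n + 1) ^ CARD('d)) * infsum (interaction_norm U) {A \<in> finite_regions. 0 \<in> A \<and> \<not> A \<subseteq> int_box (- int R) (int R)}
    + (real ((n + 1) ^ CARD('d)) - real ((n + 1 - 2 * R) ^ CARD('d))) * site_norm U"
proof -
  let ?I = "int_box (int R) (int n - int R) :: (int ^ 'd) set"
  let ?T = "infsum (interaction_norm U) {A \<in> finite_regions. 0 \<in> A \<and> \<not> A \<subseteq> int_box (- int R) (int R)}"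
  let ?b = "\<lambda>x. infsum (interaction_norm U) {A \<in> finite_regions. x \<in> A \<and> \<not> A \<subseteq> cube n}"
  have s: "interaction_norm U summable_on {A \<in> finite_regions. x \<in> A \<and> \<not> A \<subseteq> cube n}" for x
    by (rule summable_on_subset_banach[OF summable_at[of x]]) auto
  have I: "?I \<subseteq> cube n"
  proof
    fix x assume "x \<in> ?I"
    then have "int R \<le> x $ i \<and> x $ i \<le> int n - int R" for i by (simp add: int_box_def)
    then have "0 \<le> x $ i \<and> x $ i \<le> int n" for i by (smt (verit) of_nat_0_le_iff)
    then show "x \<in> cube n" by (simp add: cube_def)
  qed
  have cI: "card ?I = (n + 1 - 2 * R) ^ CARD('d)"
  proof -
    have "nat (int n - int R - int R + 1) = n + 1 - 2 * R" using assms by linarith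
    then show ?thesis by (simp add: card_int_box)
  qed
  have T: "0 \<le> ?T" by (rule infsum_nonneg) (auto simp: interaction_norm_nonneg)
  have "boundary_norm U (cube n) = infsum (interaction_norm U) (\<Union>x\<in>cube n. {A \<in> finite_regions. x \<in> A \<and> \<not> A \<subseteq> cube n})"
    unfolding boundary_norm_def by (rule infsum_cong_neutral) auto
  also have "\<dots> \<le> (\<Sum>x\<in>cube n. ?b x)"
    using infsum_UN_le[of "cube n" "interaction_norm U" "\<lambda>x. {A \<in> finite_regions. x \<in> A \<and> \<not> A \<subseteq> cube n}", OF _ s]
    by (auto simp: interaction_norm_nonneg)
  also have "\<dots> = (\<Sum>x\<in>?I. ?b x) + (\<Sum>x\<in>cube n - ?I. ?b x)"
    using sum.subset_diff[OF I, of ?b] by simp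
  also have "(\<Sum>x\<in>?I. ?b x) \<le> (\<Sum>x\<in>?I. ?T)"
    by (intro sum_mono infsum_at_boundary_le)
  also have "\<dots> \<le> real ((n + 1) ^ CARD('d)) * ?T"
    using T card_mono[OF _ I] by (simp add: card_cube mult_right_mono flip: of_nat_le_iff[where 'a = real])
  also have "(\<Sum>x\<in>cube n - ?I. ?b x) \<le> (\<Sum>x\<in>cube n - ?I. site_norm U)"
  proof (rule sum_mono)
    fix x
    show "?b x \<le> site_norm U"
      unfolding infsum_at[of x, symmetric]
      by (rule infsum_mono2[OF s summable_at]) (auto simp: interaction_norm_nonneg)
  qed
  also have "\<dots> = (real ((n + 1) ^ CARD('d)) - real ((n + 1 - 2 * R) ^ CARD('d))) * site_norm U"
    using I card_mono[OF _ I] by (simp add: card_Diff_subset card_cube cI of_nat_diff)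
  finally show ?thesis by simp
qed

text \<open>The order of choices matters: \<open>R\<close> is fixed first to make the tail small,
  then the proportion of shell sites vanishes as the cube grows.\<close>

lemma boundary_norm_tendsto:
  "(\<lambda>n. boundary_norm U (cube n) / real (n + 1) ^ CARD('d)) \<longlonglongrightarrow> 0"
proof (rule LIMSEQ_I)
  fix r :: real assume r: "r > 0"
  obtain R :: nat where R: "infsum (interaction_norm U) {A \<in> finite_regions. 0 \<in> A \<and> \<not> A \<subseteq> int_box (- int R) (int R)} \<le> r / 2"
    using tail_small[of "r/2"] r by auto
  have "(\<lambda>n. r / 2 + (1 - (real (n + 1 - 2 * R) / real (n + 1)) ^ CARD('d)) * site_norm U)
    \<longlonglongrightarrow> r / 2 + (1 - 1 ^ CARD('d)) * site_norm U"
  proof (intro tendsto_intros)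
    have "(\<lambda>n. (real n + 1 - 2 * real R) / (real n + 1)) \<longlonglongrightarrow> 1" by real_asymp
    then show "(\<lambda>n. real (n + 1 - 2 * R) / real (n + 1)) \<longlonglongrightarrow> 1"
      by (rule Lim_transform_eventually)
         (use eventually_ge_at_top[of "2 * R"] in eventually_elim, simp add: of_nat_diff add_ac)
  qed
  then have "\<forall>\<^sub>F n in sequentially. r / 2 + (1 - (real (n + 1 - 2 * R) / real (n + 1)) ^ CARD('d)) * site_norm U < r"
    by (rule order_tendstoD) (use r in simp)
  then have "\<forall>\<^sub>F n in sequentially. norm (boundary_norm U (cube n) / real (n + 1) ^ CARD('d) - 0) < r"
    using eventually_ge_at_top[of "2 * R"]
  proof eventually_elim
    case (elim n)
    let ?N = "real (n + 1) ^ CARD('d)"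
    have N: "?N > 0" by simp
    have "boundary_norm U (cube n) \<le> ?N * (r / 2) + (?N - real ((n + 1 - 2 * R)) ^ CARD('d)) * site_norm U"
      using boundary_norm_cube_le[OF elim(2)] mult_left_mono[OF R, of ?N] N unfolding of_nat_power by linarith
    then have "boundary_norm U (cube n) / ?N \<le> (?N * (r / 2) + (?N - real ((n + 1 - 2 * R)) ^ CARD('d)) * site_norm U) / ?N"
      using N by (simp add: divide_right_mono)
    also have "\<dots> = r / 2 + (1 - (real (n + 1 - 2 * R) / real (n + 1)) ^ CARD('d)) * site_norm U"
      using N by (simp add: field_simps power_divide)
    finally show ?case
      using elim(1) boundary_norm_nonneg N by (simp add: abs_of_nonneg)
  qed
  then show "\<exists>no. \<forall>n\<ge>no. norm (boundary_norm U (cube n) / real (n + 1) ^ CARD('d) - 0) < r"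
    by (simp add: eventually_sequentially)
qed

end

section \<open>Partition functions and pressure\<close>

definition energy :: "('a, 'd::finite) interaction \<Rightarrow> (int ^ 'd) set \<Rightarrow> ('a, 'd) config \<Rightarrow> real" where
  "energy U \<Lambda> \<sigma> = (\<Sum>A \<in> {A \<in> finite_regions. A \<subseteq> \<Lambda>}. U A \<sigma>)"

definition partition_fn :: "('a, 'd::finite) interaction \<Rightarrow> (int ^ 'd) set \<Rightarrow> real" where
  "partition_fn U \<Lambda> = (\<Sum>\<sigma> \<in> \<Lambda> \<rightarrow>\<^sub>E UNIV. exp (- energy U \<Lambda> \<sigma>))"

lemma finite_subregions: "finite \<Lambda> \<Longrightarrow> finite {A \<in> finite_regions. A \<subseteq> \<Lambda>}"
  by (rule finite_subset[of _ "Pow \<Lambda>"]) auto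

text \<open>The logarithm of a sum of exponentials is 1-Lipschitz in the uniform norm. Every
  comparison of energies passes to partition functions through this fact.\<close>

lemma ln_sum_exp_diff_le:
  fixes f g :: "'b \<Rightarrow> real"
  assumes "finite S" "S \<noteq> {}" "\<And>s. s \<in> S \<Longrightarrow> \<bar>f s - g s\<bar> \<le> D"
  shows "\<bar>ln (\<Sum>s\<in>S. exp (f s)) - ln (\<Sum>s\<in>S. exp (g s))\<bar> \<le> D"
proof -
  have le: "ln (\<Sum>s\<in>S. exp (f s)) \<le> D + ln (\<Sum>s\<in>S. exp (g s))"
    if "\<And>s. s \<in> S \<Longrightarrow> f s \<le> D + g s" for f g :: "'b \<Rightarrow> real"
  proof -
    have pos: "0 < (\<Sum>s\<in>S. exp (h s))" for h :: "'b \<Rightarrow> real"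
      by (rule sum_pos) (use assms in auto)
    have "(\<Sum>s\<in>S. exp (f s)) \<le> (\<Sum>s\<in>S. exp D * exp (g s))"
      by (intro sum_mono) (simp add: that flip: exp_add)
    then have "(\<Sum>s\<in>S. exp (f s)) \<le> exp D * (\<Sum>s\<in>S. exp (g s))"
      by (simp add: sum_distrib_left)
    then have "ln (\<Sum>s\<in>S. exp (f s)) \<le> ln (exp D * (\<Sum>s\<in>S. exp (g s)))"
      using pos by (subst ln_le_cancel_iff) auto
    also have "\<dots> = D + ln (\<Sum>s\<in>S. exp (g s))"
      using pos[of g] by (simp add: ln_mult)
    finally show ?thesis .
  qed
  have "f s \<le> D + g s" "g s \<le> D + f s" if "s \<in> S" for s
    using assms(3)[OF that] by auto
  then have "ln (\<Sum>s\<in>S. exp (f s)) \<le> D + ln (\<Sum>s\<in>S. exp (g s))"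
    "ln (\<Sum>s\<in>S. exp (g s)) \<le> D + ln (\<Sum>s\<in>S. exp (f s))"
    by (auto intro: le)
  then show ?thesis by simp
qed

text \<open>The two hypotheses on restrictions say that \<open>f\<close> sees only \<open>X\<close>
  and \<open>g\<close> only \<open>Y\<close>; a configuration on the disjoint union is then a pair
  of configurations chosen separately.\<close>

lemma sum_PiE_Un_prod:
  fixes f g :: "('b \<Rightarrow> 'c) \<Rightarrow> real"
  assumes "X \<inter> Y = {}"
    and "\<And>\<sigma>. f (restrict \<sigma> X) = f \<sigma>" "\<And>\<sigma>. g (restrict \<sigma> Y) = g \<sigma>"
  shows "(\<Sum>\<sigma> \<in> X \<union> Y \<rightarrow>\<^sub>E T. f \<sigma> * g \<sigma>) = (\<Sum>\<sigma> \<in> X \<rightarrow>\<^sub>E T. f \<sigma>) * (\<Sum>\<sigma> \<in> Y \<rightarrow>\<^sub>E T. g \<sigma>)"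
proof -
  have "(\<Sum>\<sigma> \<in> X \<rightarrow>\<^sub>E T. f \<sigma>) * (\<Sum>\<sigma> \<in> Y \<rightarrow>\<^sub>E T. g \<sigma>) =
    (\<Sum>(a, b) \<in> (X \<rightarrow>\<^sub>E T) \<times> (Y \<rightarrow>\<^sub>E T). f a * g b)"
    by (simp add: sum_product sum.cartesian_product)
  also have "\<dots> = (\<Sum>\<sigma> \<in> X \<union> Y \<rightarrow>\<^sub>E T. f \<sigma> * g \<sigma>)"
  proof (rule sum.reindex_bij_witness[where j = "\<lambda>(a, b). \<lambda>x. if x \<in> X then a x else b x"
        and i = "\<lambda>\<sigma>. (restrict \<sigma> X, restrict \<sigma> Y)"], goal_cases)
    case (1 p)
    then show ?case using assms(1) by (auto simp: fun_eq_iff PiE_def extensional_def)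
  next
    case (2 p)
    then show ?case using assms(1) by (auto simp: PiE_def extensional_def Pi_def)
  next
    case (3 \<sigma>)
    then show ?case by (auto simp: fun_eq_iff PiE_def extensional_def)
  next
    case (4 \<sigma>)
    then show ?case by (auto simp: PiE_def extensional_def Pi_def)
  next
    case (5 p)
    obtain a b where p: "p = (a, b)" by force
    have "f a = f (\<lambda>x. if x \<in> X then a x else b x)"
      by (subst (1 2) assms(2)[symmetric], rule arg_cong[of _ _ f]) (auto simp: fun_eq_iff)
    moreover have "g b = g (\<lambda>x. if x \<in> X then a x else b x)"
      by (subst (1 2) assms(3)[symmetric], rule arg_cong[of _ _ g]) (use assms(1) in \<open>auto simp: fun_eq_iff\<close>)
    ultimately show ?case by (simp add: p)
  qed
  finally show ?thesis by simp
qed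

lemma partition_fn_empty [simp]: "partition_fn U {} = 1"
  by (simp add: partition_fn_def energy_def finite_regions_def)

lemma partition_fn_pos: "finite \<Lambda> \<Longrightarrow> 0 < partition_fn (U :: ('a::finite, 'd::finite) interaction) \<Lambda>"
  unfolding partition_fn_def by (rule sum_pos) (auto intro!: finite_PiE simp: PiE_eq_empty_iff)

lemma restrict_shift_shift:
  assumes "\<eta> \<in> (\<lambda>y. y + x) ` \<Lambda> \<rightarrow>\<^sub>E UNIV"
  shows "restrict (shift (- x) (restrict (shift x \<eta>) \<Lambda>)) ((\<lambda>y. y + x) ` \<Lambda>) = \<eta>"
  using assms by (auto simp: fun_eq_iff shift_def PiE_def extensional_def)

context summable_interaction begin

lemma energy_cong:
  assumes "finite \<Lambda>" "restrict \<sigma> \<Lambda> = restrict \<sigma>' \<Lambda>"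
  shows "energy U \<Lambda> \<sigma> = energy U \<Lambda> \<sigma>'"
  unfolding energy_def
proof (intro sum.cong refl local)
  fix A assume "A \<in> {A \<in> finite_regions. A \<subseteq> \<Lambda>}"
  then show "A \<in> finite_regions" "restrict \<sigma> A = restrict \<sigma>' A"
    using assms(2) by (auto simp: fun_eq_iff restrict_def) (meson subsetD)
qed

lemma energy_restrict [simp]: "finite \<Lambda> \<Longrightarrow> energy U \<Lambda> (restrict \<sigma> \<Lambda>) = energy U \<Lambda> \<sigma>"
  by (rule energy_cong) auto

lemma sum_interaction_le:
  assumes "finite R" "R \<subseteq> S" "S \<subseteq> finite_regions" "interaction_norm U summable_on S"
  shows "\<bar>\<Sum>A\<in>R. U A \<sigma>\<bar> \<le> infsum (interaction_norm U) S"
proof -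
  have "\<bar>\<Sum>A\<in>R. U A \<sigma>\<bar> \<le> (\<Sum>A\<in>R. \<bar>U A \<sigma>\<bar>)" by (rule sum_abs)
  also have "\<dots> \<le> (\<Sum>A\<in>R. interaction_norm U A)"
    using assms by (intro sum_mono le_interaction_norm) auto
  also have "\<dots> \<le> infsum (interaction_norm U) S"
    using assms by (intro finite_sum_le_infsum interaction_norm_nonneg) auto
  finally show ?thesis .
qed

text \<open>A region inside the union but inside neither part meets \<open>\<Lambda>\<close> without
  being contained in it, so it is counted by the boundary norm of \<open>\<Lambda>\<close> alone.
  This asymmetry lets parts be attached one at a time, each at the price of its own
  boundary.\<close>

lemma energy_Un:
  assumes "finite \<Lambda>" "finite \<Gamma>" "\<Lambda> \<inter> \<Gamma> = {}"
  shows "\<bar>energy U (\<Lambda> \<union> \<Gamma>) \<sigma> - (energy U \<Lambda> \<sigma> + energy U \<Gamma> \<sigma>)\<bar> \<le> boundary_norm U \<Lambda>"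
proof -
  let ?P = "\<lambda>\<Lambda>. {A \<in> finite_regions. A \<subseteq> \<Lambda>}"
  let ?R = "?P (\<Lambda> \<union> \<Gamma>) - (?P \<Lambda> \<union> ?P \<Gamma>)"
  have fin: "finite (?P \<Lambda>)" "finite (?P \<Gamma>)" "finite (?P (\<Lambda> \<union> \<Gamma>))"
    using assms by (auto intro: finite_subregions)
  have "energy U (\<Lambda> \<union> \<Gamma>) \<sigma> = (\<Sum>A\<in>?R. U A \<sigma>) + (\<Sum>A\<in>?P \<Lambda> \<union> ?P \<Gamma>. U A \<sigma>)"
    unfolding energy_def by (rule sum.subset_diff) (use fin in auto)
  also have "(\<Sum>A\<in>?P \<Lambda> \<union> ?P \<Gamma>. U A \<sigma>) = energy U \<Lambda> \<sigma> + energy U \<Gamma> \<sigma>"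
    unfolding energy_def
    by (rule sum.union_disjoint) (use fin assms(3) in \<open>auto simp: finite_regions_def\<close>)
  finally have "energy U (\<Lambda> \<union> \<Gamma>) \<sigma> - (energy U \<Lambda> \<sigma> + energy U \<Gamma> \<sigma>) = (\<Sum>A\<in>?R. U A \<sigma>)"
    by simp
  also have "\<bar>\<dots>\<bar> \<le> boundary_norm U \<Lambda>"
    unfolding boundary_norm_def
    by (rule sum_interaction_le) (use fin summable_boundary[OF assms(1)] in auto)
  finally show ?thesis .
qed

lemma abs_energy_le:
  assumes "finite \<Lambda>"
  shows "\<bar>energy U \<Lambda> \<sigma>\<bar> \<le> real (card \<Lambda>) * site_norm U"
proof -
  have "\<bar>energy U \<Lambda> \<sigma>\<bar> \<le> infsum (interaction_norm U) {A \<in> finite_regions. A \<inter> \<Lambda> \<noteq> {}}"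
    unfolding energy_def
    by (rule sum_interaction_le)
       (use assms summable_touching(1)[OF assms] in \<open>auto intro: finite_subregions simp: finite_regions_def\<close>)
  with summable_touching(2)[OF assms] show ?thesis by linarith
qed

lemma energy_translate:
  "energy U ((\<lambda>y. y + x) ` \<Lambda>) (shift (- x) \<sigma>) = energy U \<Lambda> \<sigma>"
proof -
  have "energy U \<Lambda> \<sigma> = (\<Sum>A \<in> {A \<in> finite_regions. A \<subseteq> \<Lambda>}. U ((\<lambda>y. y + x) ` A) (shift (- x) \<sigma>))"
    unfolding energy_def by (rule sum.cong) (auto simp: translate)
  also have "\<dots> = energy U ((\<lambda>y. y + x) ` \<Lambda>) (shift (- x) \<sigma>)"
    unfolding energy_def
  proof (rule sum.reindex_bij_witness[where j = "\<lambda>A. (\<lambda>y. y + x) ` A" and i = "\<lambda>A. (\<lambda>y. y + (- x)) ` A"],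
      goal_cases)
    case (4 A)
    then have "A \<in> finite_regions" by simp
    then have "(\<lambda>y. y + (- x)) ` A \<in> finite_regions" by (simp only: finite_regions_translate)
    then show ?case using 4 by auto
  qed (auto simp: image_image)
  finally show ?thesis by simp
qed

lemma partition_fn_translate:
  assumes "finite \<Lambda>"
  shows "partition_fn U ((\<lambda>y. y + x) ` \<Lambda>) = partition_fn U \<Lambda>"
  unfolding partition_fn_def
proof (rule sum.reindex_bij_witness[where i = "\<lambda>\<eta>. restrict (shift (- x) \<eta>) ((\<lambda>y. y + x) ` \<Lambda>)"
      and j = "\<lambda>\<eta>. restrict (shift x \<eta>) \<Lambda>"], goal_cases)
  case (1 \<eta>)
  then show ?case by (rule restrict_shift_shift)
next
  case (3 \<eta>)
  then show ?case by (auto simp: fun_eq_iff shift_def PiE_def extensional_def)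
next
  case (5 \<eta>)
  have "energy U \<Lambda> (restrict (shift x \<eta>) \<Lambda>) = energy U \<Lambda> (shift x \<eta>)"
    using assms by simp
  also have "\<dots> = energy U ((\<lambda>y. y + x) ` \<Lambda>) (shift (- x) (shift x \<eta>))"
    by (simp add: energy_translate)
  also have "\<dots> = energy U ((\<lambda>y. y + x) ` \<Lambda>) \<eta>"
    by (simp add: shift_def)
  finally show ?case by simp
qed auto

lemma ln_partition_fn_Un:
  assumes "finite \<Lambda>" "finite \<Gamma>" "\<Lambda> \<inter> \<Gamma> = {}"
  shows "\<bar>ln (partition_fn U (\<Lambda> \<union> \<Gamma>)) - (ln (partition_fn U \<Lambda>) + ln (partition_fn U \<Gamma>))\<bar> \<le> boundary_norm U \<Lambda>"
proof -
  have "(\<Sum>\<sigma> \<in> \<Lambda> \<union> \<Gamma> \<rightarrow>\<^sub>E UNIV. exp (- (energy U \<Lambda> \<sigma> + energy U \<Gamma> \<sigma>))) =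
    partition_fn U \<Lambda> * partition_fn U \<Gamma>"
    unfolding partition_fn_def
    using sum_PiE_Un_prod[OF assms(3), of "\<lambda>\<sigma>. exp (- energy U \<Lambda> \<sigma>)" "\<lambda>\<sigma>. exp (- energy U \<Gamma> \<sigma>)" UNIV] assms
    by (simp add: exp_add[symmetric] exp_diff exp_minus field_simps)
  then have "ln (partition_fn U \<Lambda>) + ln (partition_fn U \<Gamma>) =
    ln (\<Sum>\<sigma> \<in> \<Lambda> \<union> \<Gamma> \<rightarrow>\<^sub>E UNIV. exp (- (energy U \<Lambda> \<sigma> + energy U \<Gamma> \<sigma>)))"
    using partition_fn_pos[OF assms(1), of U] partition_fn_pos[OF assms(2), of U] by (simp add: ln_mult)
  moreover have "\<bar>ln (partition_fn U (\<Lambda> \<union> \<Gamma>)) -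
     ln (\<Sum>\<sigma> \<in> \<Lambda> \<union> \<Gamma> \<rightarrow>\<^sub>E UNIV. exp (- (energy U \<Lambda> \<sigma> + energy U \<Gamma> \<sigma>)))\<bar> \<le> boundary_norm U \<Lambda>"
    unfolding partition_fn_def
    using assms energy_Un[OF assms]
    by (intro ln_sum_exp_diff_le) (auto intro!: finite_PiE simp: PiE_eq_empty_iff abs_minus_commute algebra_simps)
  ultimately show ?thesis by simp
qed

text \<open>Comparison with the zero interaction, whose partition function just counts the
  configurations.\<close>

lemma abs_ln_partition_fn_le:
  assumes "finite \<Lambda>"
  shows "\<bar>ln (partition_fn U \<Lambda>)\<bar> \<le> real (card \<Lambda>) * (site_norm U + ln (real CARD('a)))"
proof -
  have "\<bar>ln (partition_fn U \<Lambda>) - ln (\<Sum>\<sigma> \<in> \<Lambda> \<rightarrow>\<^sub>E (UNIV :: 'a set). exp 0)\<bar> \<le> real (card \<Lambda>) * site_norm U"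
    unfolding partition_fn_def
    using assms abs_energy_le[OF assms]
    by (intro ln_sum_exp_diff_le) (auto intro!: finite_PiE simp: PiE_eq_empty_iff)
  moreover have "ln (\<Sum>\<sigma> \<in> \<Lambda> \<rightarrow>\<^sub>E (UNIV :: 'a set). exp 0) = real (card \<Lambda>) * ln (real CARD('a))"
    using assms by (simp add: card_PiE ln_realpow)
  moreover have "0 \<le> real (card \<Lambda>) * ln (real CARD('a))"
    by (simp add: Suc_leI)
  ultimately show ?thesis
    unfolding distrib_left by linarith
qed

lemma ln_partition_fn_disjoint_family:
  assumes "finite I" "\<And>i. i \<in> I \<Longrightarrow> finite (\<Lambda> i)" "disjoint_family_on \<Lambda> I"
  shows "\<bar>ln (partition_fn U (\<Union>i\<in>I. \<Lambda> i)) - (\<Sum>i\<in>I. ln (partition_fn U (\<Lambda> i)))\<bar> \<le> (\<Sum>i\<in>I. boundary_norm U (\<Lambda> i))"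
  using assms
proof (induction I)
  case empty
  then show ?case by simp
next
  case (insert i I)
  have "\<Lambda> i \<inter> (\<Union>j\<in>I. \<Lambda> j) = {}"
    using insert.prems(2) insert.hyps(2) by (auto simp: disjoint_family_on_def)
  then have "\<bar>ln (partition_fn U (\<Lambda> i \<union> (\<Union>j\<in>I. \<Lambda> j))) - (ln (partition_fn U (\<Lambda> i)) + ln (partition_fn U (\<Union>j\<in>I. \<Lambda> j)))\<bar> \<le> boundary_norm U (\<Lambda> i)"
    using insert.prems insert.hyps by (intro ln_partition_fn_Un) auto
  moreover have "disjoint_family_on \<Lambda> I"
    using insert.prems(2) by (auto simp: disjoint_family_on_def)
  then have "\<bar>ln (partition_fn U (\<Union>j\<in>I. \<Lambda> j)) - (\<Sum>j\<in>I. ln (partition_fn U (\<Lambda> j)))\<bar> \<le> (\<Sum>j\<in>I. boundary_norm U (\<Lambda> j))"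
    using insert.prems(1) by (intro insert.IH) auto
  ultimately show ?case
    unfolding sum.insert[OF insert.hyps] UN_insert by linarith
qed

end

section \<open>Tilings by cubes and existence of the pressure\<close>

lemma int_box_tiling:
  fixes n k :: nat
  shows "(\<Union>j \<in> int_box 0 (int k - 1). (\<lambda>y. y + int (n + 1) *s j) ` cube n) =
    (int_box 0 (int (k * (n + 1)) - 1) :: (int ^ 'd::finite) set)" (is "?L = ?R")
proof (intro set_eqI iffI)
  fix x :: "int ^ 'd" assume "x \<in> ?L"
  then obtain j y where j: "\<And>i. 0 \<le> j $ i" "\<And>i. j $ i \<le> int k - 1"
    and y: "\<And>i. 0 \<le> y $ i" "\<And>i. y $ i \<le> int n" and x: "x = y + int (n + 1) *s j"
    by (auto simp: int_box_def cube_def)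
  have "x $ i \<le> int (k * (n + 1)) - 1" for i
  proof -
    have "x $ i \<le> int n + int (n + 1) * (int k - 1)"
      unfolding x vector_add_component vector_smult_component
      by (intro add_mono y mult_left_mono j) simp
    then show ?thesis by (simp add: algebra_simps)
  qed
  moreover have "0 \<le> x $ i" for i
    unfolding x using y(1)[of i] j(1)[of i] by simp
  ultimately show "x \<in> ?R" by (simp add: int_box_def)
next
  fix x :: "int ^ 'd" assume "x \<in> ?R"
  then have x: "0 \<le> x $ i" "x $ i \<le> int (k * (n + 1)) - 1" for i
    by (simp_all add: int_box_def)
  \<comment> \<open>The period is n + 1, not n, because \<open>cube n\<close> includes both
    endpoints.\<close>
  define j where "j = (\<chi> i. x $ i div int (n + 1))"
  define y where "y = (\<chi> i. x $ i mod int (n + 1))"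
  have "x = y + int (n + 1) *s j"
    unfolding j_def y_def vec_eq_iff by (metis mod_mult_div_eq vec_lambda_beta vector_add_component vector_smult_component)
  moreover have "y \<in> cube n"
    unfolding y_def cube_def by (auto simp: zle_diff1_eq[symmetric] simp del: zle_diff1_eq) (smt (verit) of_nat_0_le_iff pos_mod_bound)
  moreover have "j $ i \<le> int k - 1" for i
  proof -
    have "x $ i < int k * int (n + 1)" using x(2)[of i] by (simp add: algebra_simps)
    moreover have "x $ i div int (n + 1) * int (n + 1) \<le> x $ i"
      by (simp add: minus_mod_eq_div_mult[symmetric])
    ultimately have "x $ i div int (n + 1) * int (n + 1) < int k * int (n + 1)" by linarith
    then have "x $ i div int (n + 1) < int k" by (rule mult_right_less_imp_less) simp
    then show ?thesis by (simp add: j_def)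
  qed
  moreover have "0 \<le> j $ i" for i
    using x(1)[of i] by (simp add: j_def pos_imp_zdiv_nonneg_iff)
  ultimately show "x \<in> ?L" by (auto simp: int_box_def)
qed

lemma int_box_tiling_disjoint:
  fixes n :: nat
  shows "disjoint_family_on (\<lambda>j. (\<lambda>y. y + int (n + 1) *s j) ` (cube n :: (int ^ 'd::finite) set)) J"
  unfolding disjoint_family_on_def
proof (intro ballI impI)
  fix j j' :: "int ^ 'd" assume "j \<noteq> j'"
  show "(\<lambda>y. y + int (n + 1) *s j) ` cube n \<inter> (\<lambda>y. y + int (n + 1) *s j') ` cube n = {}"
  proof (rule ccontr)
    assume "(\<lambda>y. y + int (n + 1) *s j) ` (cube n :: (int ^ 'd) set) \<inter> (\<lambda>y. y + int (n + 1) *s j') ` cube n \<noteq> {}"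
    then obtain y y' where y: "y \<in> cube n" "y' \<in> cube n" "y + int (n + 1) *s j = y' + int (n + 1) *s j'"
      by auto
    \<comment> \<open>The quotient by the period recovers the index of the tile, so a common point
      forces equal indices.\<close>
    have div: "(y + int (n + 1) *s j) $ i div int (n + 1) = j $ i" if "y \<in> cube n" for y j :: "int ^ 'd" and i
    proof -
      have "0 \<le> y $ i" "y $ i < int (n + 1)"
        using that by (simp_all add: cube_def zless_add1_eq order_le_less add.commute[of 1])
      then have "y $ i div int (n + 1) = 0" by (rule div_pos_pos_trivial)
      moreover have "(y $ i + int (n + 1) * j $ i) div int (n + 1) = j $ i + y $ i div int (n + 1)"
        by (rule div_mult_self2) simp
      ultimately show ?thesis by (simp only: vector_add_component vector_smult_component)
    qed
    have "j $ i = j' $ i" for i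
      by (metis div y)
    with \<open>j \<noteq> j'\<close> show False by (simp add: vec_eq_iff)
  qed
qed

context summable_interaction begin

lemma ln_partition_fn_tiling:
  "\<bar>ln (partition_fn U (int_box 0 (int (k * (n + 1)) - 1))) - real k ^ CARD('d) * ln (partition_fn U (cube n))\<bar>
    \<le> real k ^ CARD('d) * boundary_norm U (cube n)"
proof -
  let ?J = "int_box 0 (int k - 1) :: (int ^ 'd) set"
  have "card ?J = k ^ CARD('d)" by (simp add: card_int_box)
  with ln_partition_fn_disjoint_family[OF _ _ int_box_tiling_disjoint[of n], of ?J]
  show ?thesis
    by (simp add: int_box_tiling[of n k, simplified] partition_fn_translate boundary_norm_translate)
qed

text \<open>Each removed site costs one \<open>site_norm U\<close> for the coupling to the rest and
  \<open>site_norm U + ln (real CARD('a))\<close> for the partition function of the removed part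
  itself.\<close>

lemma ln_partition_fn_subset:
  assumes "finite \<Lambda>" "\<Gamma> \<subseteq> \<Lambda>"
  shows "\<bar>ln (partition_fn U \<Lambda>) - ln (partition_fn U \<Gamma>)\<bar> \<le>
    (real (card \<Lambda>) - real (card \<Gamma>)) * (2 * site_norm U + ln (real CARD('a)))"
proof -
  let ?X = "\<Lambda> - \<Gamma>"
  have fin: "finite \<Gamma>" "finite ?X" using assms finite_subset by auto
  have eq: "?X \<union> \<Gamma> = \<Lambda>" using assms by auto
  have "\<bar>ln (partition_fn U \<Lambda>) - (ln (partition_fn U ?X) + ln (partition_fn U \<Gamma>))\<bar> \<le> boundary_norm U ?X"
    using ln_partition_fn_Un[of ?X \<Gamma>] fin unfolding eq by blast
  moreover have "boundary_norm U ?X \<le> real (card ?X) * site_norm U"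
    using fin by (intro boundary_norm_le_card)
  moreover have "\<bar>ln (partition_fn U ?X)\<bar> \<le> real (card ?X) * (site_norm U + ln (real CARD('a)))"
    using fin by (intro abs_ln_partition_fn_le)
  moreover have "real (card ?X) = real (card \<Lambda>) - real (card \<Gamma>)"
    using assms fin card_mono[OF assms] by (simp add: card_Diff_subset of_nat_diff)
  ultimately show ?thesis
    by (simp add: algebra_simps)
qed

text \<open>\<open>\<rho>\<close> is the proportion of the large cube covered by k^d tiles. The term
  with \<open>1 - \<rho>\<close> occurs twice: once for the uncovered sites, and once for replacing
  \<open>\<rho>\<close> by 1 in front of the normalised logarithm of a tile.\<close>

lemma ln_partition_fn_cube_compare:
  assumes "k * (n + 1) \<le> N + 1"
  defines "\<rho> \<equiv> (real (k * (n + 1)) / real (N + 1)) ^ CARD('d)"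
  shows "\<bar>ln (partition_fn U (cube N)) / real (N + 1) ^ CARD('d)
      - ln (partition_fn U (cube n)) / real (n + 1) ^ CARD('d)\<bar>
    \<le> boundary_norm U (cube n) / real (n + 1) ^ CARD('d)
      + 2 * (1 - \<rho>) * (2 * site_norm U + ln (real CARD('a)))"
proof -
  let ?K = "int_box 0 (int (k * (n + 1)) - 1) :: (int ^ 'd) set"
  let ?C = "2 * site_norm U + ln (real CARD('a))"
  let ?N = "real (N + 1) ^ CARD('d)" and ?n = "real (n + 1) ^ CARD('d)"
  let ?Z = "\<lambda>\<Lambda>. ln (partition_fn U \<Lambda>)"
  have C: "0 \<le> ?C" using site_norm_nonneg by (simp add: Suc_leI)
  have K: "?K \<subseteq> cube N"
  proof
    fix x assume "x \<in> ?K"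
    then have *: "0 \<le> x $ i \<and> x $ i \<le> int (k * (n + 1)) - 1" for i by (simp add: int_box_def)
    have "x $ i \<le> int N" for i
      using *[of i] assms(1) by linarith
    with * show "x \<in> cube N" by (simp add: cube_def)
  qed
  have rho: "0 \<le> \<rho>" "\<rho> \<le> 1"
    using assms(1) unfolding \<rho>_def
    by (auto intro!: power_le_one simp del: of_nat_mult of_nat_Suc simp flip: of_nat_le_iff[where 'a = real])
  have N: "?N > 0" "?n > 0" by simp_all
  have cK: "real (card ?K) = \<rho> * ?N"
    using N unfolding \<rho>_def power_divide by (simp add: card_int_box)
  have cn: "real k ^ CARD('d) * ?n = \<rho> * ?N"
    using N unfolding \<rho>_def power_divide of_nat_mult power_mult_distrib by simp
  have "\<bar>?Z (cube N) - ?Z ?K\<bar> \<le> (real (card (cube N :: (int ^ 'd) set)) - real (card ?K)) * ?C"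
    using ln_partition_fn_subset[OF _ K] by simp
  then have 1: "\<bar>?Z (cube N) - ?Z ?K\<bar> \<le> (1 - \<rho>) * ?N * ?C"
    unfolding cK by (simp add: card_cube algebra_simps)
  have 2: "\<bar>?Z ?K - real k ^ CARD('d) * ?Z (cube n)\<bar> \<le> real k ^ CARD('d) * boundary_norm U (cube n)"
    by (rule ln_partition_fn_tiling)
  have 3: "\<bar>?Z (cube n)\<bar> \<le> ?n * ?C"
  proof (rule order_trans)
    show "\<bar>?Z (cube n)\<bar> \<le> ?n * (site_norm U + ln (real CARD('a)))"
      using abs_ln_partition_fn_le[of "cube n"] by (simp add: card_cube)
    show "?n * (site_norm U + ln (real CARD('a))) \<le> ?n * ?C"
      using site_norm_nonneg by (intro mult_left_mono) auto
  qed
  have k: "real k ^ CARD('d) = \<rho> * ?N / ?n"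
    using cn N by (simp add: field_simps)
  have "\<bar>?Z (cube N) - \<rho> * ?N / ?n * ?Z (cube n)\<bar> \<le> (1 - \<rho>) * ?N * ?C + \<rho> * ?N / ?n * boundary_norm U (cube n)"
    using 1 2 unfolding k by linarith
  also have "\<dots> \<le> (1 - \<rho>) * ?N * ?C + ?N / ?n * boundary_norm U (cube n)"
    using rho N boundary_norm_nonneg by (intro add_left_mono mult_right_mono divide_right_mono) auto
  finally have "\<bar>?Z (cube N) - \<rho> * ?N / ?n * ?Z (cube n)\<bar> / ?N \<le> ((1 - \<rho>) * ?N * ?C + ?N / ?n * boundary_norm U (cube n)) / ?N"
    using N by (intro divide_right_mono) auto
  also have "\<dots> = (1 - \<rho>) * ?C + boundary_norm U (cube n) / ?n"
    using N by (simp add: add_divide_distrib)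
  also have "\<bar>?Z (cube N) - \<rho> * ?N / ?n * ?Z (cube n)\<bar> / ?N = \<bar>(?Z (cube N) - \<rho> * ?N / ?n * ?Z (cube n)) / ?N\<bar>"
    using N by (simp add: abs_divide)
  also have "(?Z (cube N) - \<rho> * ?N / ?n * ?Z (cube n)) / ?N = ?Z (cube N) / ?N - \<rho> * (?Z (cube n) / ?n)"
    using N by (simp add: diff_divide_distrib)
  finally have A: "\<bar>?Z (cube N) / ?N - \<rho> * (?Z (cube n) / ?n)\<bar> \<le> (1 - \<rho>) * ?C + boundary_norm U (cube n) / ?n" .
  have "\<bar>?Z (cube n) / ?n\<bar> \<le> ?C"
    using 3 N by (simp add: abs_divide divide_le_eq mult.commute)
  then have "\<bar>(1 - \<rho>) * (?Z (cube n) / ?n)\<bar> \<le> (1 - \<rho>) * ?C"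
    unfolding abs_mult using rho by (intro mult_mono) auto
  then have "\<bar>?Z (cube n) / ?n - \<rho> * (?Z (cube n) / ?n)\<bar> \<le> (1 - \<rho>) * ?C"
    by (simp only: left_diff_distrib mult_1)
  with A show ?thesis by linarith
qed

text \<open>Once a tile with small boundary term is fixed, all sufficiently large cubes have nearly
  its normalised logarithm, hence nearly that of one another. No candidate for the limit is
  needed.\<close>

lemma ln_partition_fn_Cauchy:
  "Cauchy (\<lambda>n. ln (partition_fn U (cube n)) / real (n + 1) ^ CARD('d))"
proof (rule metric_CauchyI)
  fix e :: real assume e: "e > 0"
  let ?C = "2 * site_norm U + ln (real CARD('a))"
  let ?a = "\<lambda>n. ln (partition_fn U (cube n)) / real (n + 1) ^ CARD('d)"
  have "\<forall>\<^sub>F n in sequentially. boundary_norm U (cube n) / real (n + 1) ^ CARD('d) < e / 4"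
    using boundary_norm_tendsto by (rule order_tendstoD) (use e in simp)
  then obtain n where n: "boundary_norm U (cube n) / real (n + 1) ^ CARD('d) < e / 4"
    by (auto simp: eventually_sequentially)
  \<comment> \<open>As many tiles per side as fit; fewer than n + 1 sites per side stay uncovered,
    so the proportion tends to 1.\<close>
  define \<rho> where "\<rho> N = (real ((N + 1) div (n + 1) * (n + 1)) / real (N + 1)) ^ CARD('d)" for N
  have "(\<lambda>N. real ((N + 1) div (n + 1) * (n + 1)) / real (N + 1)) \<longlonglongrightarrow> 1"
  proof (rule tendsto_sandwich)
    show "(\<lambda>N. 1 - real (n + 1) / real (N + 1)) \<longlonglongrightarrow> 1" by real_asymp
    show "(\<lambda>N. 1) \<longlonglongrightarrow> (1 :: real)" by simp
    show "\<forall>\<^sub>F N in sequentially. 1 - real (n + 1) / real (N + 1) \<le> real ((N + 1) div (n + 1) * (n + 1)) / real (N + 1)"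
    proof (rule always_eventually, rule allI)
      fix N
      have "N + 1 \<le> (N + 1) div (n + 1) * (n + 1) + (n + 1)"
        by (metis add_gr_0 add_left_mono div_mult_mod_eq less_imp_le mod_less_divisor zero_less_one)
      then have "real (N + 1) - real (n + 1) \<le> real ((N + 1) div (n + 1) * (n + 1))"
        by linarith
      then have "(real (N + 1) - real (n + 1)) / real (N + 1) \<le> real ((N + 1) div (n + 1) * (n + 1)) / real (N + 1)"
        by (intro divide_right_mono) auto
      then show "1 - real (n + 1) / real (N + 1) \<le> real ((N + 1) div (n + 1) * (n + 1)) / real (N + 1)"
        unfolding diff_divide_distrib by simp
    qed
    show "\<forall>\<^sub>F N in sequentially. real ((N + 1) div (n + 1) * (n + 1)) / real (N + 1) \<le> 1"
      by (rule always_eventually)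
         (metis divide_le_eq_1_pos div_times_less_eq_dividend of_nat_0_less_iff of_nat_le_iff Suc_eq_plus1 zero_less_Suc)
  qed
  then have "(\<lambda>N. 2 * (1 - \<rho> N) * ?C) \<longlonglongrightarrow> 2 * (1 - 1 ^ CARD('d)) * ?C"
    unfolding \<rho>_def by (intro tendsto_intros)
  then have "\<forall>\<^sub>F N in sequentially. 2 * (1 - \<rho> N) * ?C < e / 4"
    by (rule order_tendstoD) (use e in simp)
  then obtain N0 where N0: "\<And>N. N \<ge> N0 \<Longrightarrow> 2 * (1 - \<rho> N) * ?C < e / 4"
    by (auto simp: eventually_sequentially)
  have close: "\<bar>?a N - ?a n\<bar> < e / 2" if "N \<ge> N0" for N
  proof -
    have "\<bar>?a N - ?a n\<bar> \<le> boundary_norm U (cube n) / real (n + 1) ^ CARD('d) + 2 * (1 - \<rho> N) * ?C"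
      unfolding \<rho>_def by (rule ln_partition_fn_cube_compare) (rule div_times_less_eq_dividend)
    with n N0[OF that] show ?thesis by linarith
  qed
  show "\<exists>M. \<forall>m\<ge>M. \<forall>n\<ge>M. dist (?a m) (?a n) < e"
  proof (intro exI allI impI)
    fix p q assume "N0 \<le> p" "N0 \<le> q"
    from close[OF this(1)] close[OF this(2)] show "dist (?a p) (?a q) < e"
      unfolding dist_real_def by linarith
  qed
qed

text \<open>Gives \<open>pressure\<close> its meaning as a limit. Its definition divides by n^d
  while a cube has (n + 1)^d sites; the quotient of the two tends to 1.\<close>

lemma pressure_tendsto:
  "(\<lambda>n. ln (partition_fn U (cube n)) / real n ^ CARD('d)) \<longlonglongrightarrow> pressure U"
proof -
  obtain l where l: "(\<lambda>n. ln (partition_fn U (cube n)) / real (n + 1) ^ CARD('d)) \<longlonglongrightarrow> l"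
    using ln_partition_fn_Cauchy Cauchy_convergent_iff convergent_def by blast
  have "(\<lambda>n. (real n + 1) / real n) \<longlonglongrightarrow> 1" by real_asymp
  then have "(\<lambda>n. ((real n + 1) / real n) ^ CARD('d)) \<longlonglongrightarrow> 1 ^ CARD('d)" by (intro tendsto_intros)
  from tendsto_mult[OF l this]
  have "(\<lambda>n. ln (partition_fn U (cube n)) / real n ^ CARD('d)) \<longlonglongrightarrow> l"
    by (simp add: power_divide add.commute power_not_zero)
  moreover from this have "pressure U = l"
    unfolding pressure_def by (intro limI) (simp add: partition_fn_def energy_def)
  ultimately show ?thesis by simp
qed

text \<open>Makes all results on pressures available for multiples of the interaction;
  \<open>r\<close> may be negative, as happens for q > 1.\<close>

lemma summable_interaction_scale: "summable_interaction (\<lambda>A \<sigma>. r * U A \<sigma>)"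
proof
  have "(\<lambda>A. SUP \<sigma>. \<bar>r * U A \<sigma>\<bar>) summable_on {A \<in> finite_regions. (0 :: int ^ 'd) \<in> A}"
  proof (rule summable_on_cong[THEN iffD1])
    show "(\<lambda>A. \<bar>r\<bar> * interaction_norm U A) summable_on {A \<in> finite_regions. (0 :: int ^ 'd) \<in> A}"
      by (intro summable_on_cmult_right summable_at_0)
  next
    fix A :: "(int ^ 'd) set" assume A: "A \<in> {A \<in> finite_regions. 0 \<in> A}"
    show "\<bar>r\<bar> * interaction_norm U A = (SUP \<sigma>. \<bar>r * U A \<sigma>\<bar>)"
    proof -
      have bdd: "bdd_above (range (\<lambda>\<sigma>. \<bar>U A \<sigma>\<bar>))"
        using A le_interaction_norm by (intro bdd_aboveI) auto
      \<comment> \<open>Multiplication by a nonnegative constant is monotone and continuous, so it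
        commutes with the supremum of a bounded set.\<close>
      have "(SUP \<sigma>. \<bar>r\<bar> * \<bar>U A \<sigma>\<bar>) = \<bar>r\<bar> * (SUP \<sigma>. \<bar>U A \<sigma>\<bar>)"
        by (subst continuous_at_Sup_mono[where f = "\<lambda>t. \<bar>r\<bar> * t"])
           (use bdd in \<open>auto intro!: monoI mult_left_mono continuous_intros simp: image_image\<close>)
      then show ?thesis by (simp add: interaction_norm_def abs_mult)
    qed
  qed
  then show "translation_invariant_interaction (\<lambda>A \<sigma>. r * U A \<sigma>)"
    unfolding translation_invariant_interaction_def
  proof (intro conjI ballI allI impI, goal_cases)
    case (1 A \<sigma> \<sigma>')
    then show ?case using local[of A \<sigma> \<sigma>'] by simp
  next
    case (2 A x \<sigma>)
    then show ?case using translate[of A x \<sigma>] by simp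
  qed
qed

end

lemma partition_fn_scale:
  "partition_fn (\<lambda>A \<sigma>. r * U A \<sigma>) \<Lambda> = (\<Sum>\<sigma> \<in> \<Lambda> \<rightarrow>\<^sub>E UNIV. exp (- r * energy U \<Lambda> \<sigma>))"
  by (simp add: partition_fn_def energy_def sum_distrib_left sum_negf)

section \<open>Cylinder probabilities of a Gibbs field\<close>

lemma space_config_space [simp]: "space config_space = UNIV"
  by (simp add: config_space_def space_PiM)

definition cylinder :: "(int ^ 'd::finite) set \<Rightarrow> ('a, 'd) config \<Rightarrow> ('a, 'd) config set" where
  "cylinder \<Lambda> \<eta> = {\<sigma>. restrict \<sigma> \<Lambda> = restrict \<eta> \<Lambda>}"

lemma space_local_field [simp]: "space (local_field V) = UNIV"
  by (simp add: local_field_def)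

lemma cylinder_in_local_field:
  assumes "finite \<Lambda>"
  shows "cylinder \<Lambda> \<eta> \<in> sets (local_field \<Lambda>)"
proof -
  have eq: "cylinder \<Lambda> \<eta> = {\<sigma> \<in> space (local_field \<Lambda>). \<forall>y\<in>\<Lambda>. \<sigma> y = \<eta> y}"
    by (auto simp: cylinder_def fun_eq_iff restrict_def)
  have "{\<sigma> \<in> space (local_field \<Lambda>). \<sigma> y = \<eta> y} \<in> sets (local_field \<Lambda>)" if "y \<in> \<Lambda>" for y
    unfolding local_field_def using that by (subst sets_measure_of) (auto intro!: sigma_sets.Basic)
  then show ?thesis
    unfolding eq using assms by (intro sets.sets_Collect_finite_All) auto
qed

lemma local_field_mono:
  assumes "V \<subseteq> W" shows "sets (local_field V) \<subseteq> sets (local_field W)"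
  unfolding local_field_def using assms
  by (simp add: sets_measure_of, intro sigma_sets_mono') auto

lemma sets_local_field_subset: "sets (local_field V) \<subseteq> sets (config_space :: ('a, 'd::finite) config measure)"
proof -
  have "{\<sigma> \<in> space (config_space :: ('a, 'd) config measure). \<sigma> x = a} \<in> sets config_space" for x :: "int ^ 'd" and a
  proof -
    have "(\<lambda>\<sigma>. \<sigma> x) \<in> (config_space :: ('a, 'd) config measure) \<rightarrow>\<^sub>M count_space UNIV"
      unfolding config_space_def by (rule measurable_component_singleton) simp
    from measurable_sets[OF this, of "{a}"] show ?thesis
      by (simp add: vimage_def)
  qed
  then have "sigma_sets (space config_space) {{\<sigma>. \<sigma> x = a} |x a. x \<in> V} \<subseteq> sets (config_space :: ('a, 'd) config measure)"
    by (intro sets.sigma_sets_subset) auto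
  then show ?thesis
    by (simp add: local_field_def sets_measure_of)
qed

lemma measurable_shift: "shift x \<in> config_space \<rightarrow>\<^sub>M config_space"
  unfolding config_space_def
  by (rule measurable_PiM_single') (auto simp: shift_def PiE_UNIV_domain intro!: measurable_component_singleton)

locale translation_invariant_field = prob_space P
  for P :: "('a::finite, 'd::finite) config measure" +
  assumes sets_P: "sets P = sets config_space"
    and distr_shift: "distr P P (shift x) = P"
begin

lemma space_P [simp]: "space P = UNIV"
  using sets_eq_imp_space_eq[OF sets_P] by simp

lemma local_field_events: "A \<in> sets (local_field V) \<Longrightarrow> A \<in> events"
  using sets_local_field_subset sets_P by blast

lemma subalgebra_local_field: "subalgebra P (local_field V)"
  unfolding subalgebra_def using local_field_events by auto

lemma cylinder_events [measurable]: "finite \<Lambda> \<Longrightarrow> cylinder \<Lambda> \<eta> \<in> events"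
  using local_field_events cylinder_in_local_field by blast

lemma measurable_shift_P [measurable]: "shift x \<in> P \<rightarrow>\<^sub>M P"
  using measurable_shift measurable_cong_sets[OF sets_P sets_P] by blast

lemma prob_shift:
  assumes "A \<in> events"
  shows "prob (shift x -` A) = prob A"
proof -
  have "prob A = measure (distr P P (shift x)) A" by (simp add: distr_shift)
  also have "\<dots> = prob (shift x -` A)"
    using assms by (subst measure_distr) auto
  finally show ?thesis by simp
qed

end

context summable_interaction begin

text \<open>Regions inside \<open>\<Lambda>\<close> do not see \<open>\<zeta>\<close> and sum to the
  energy exactly; the crossing ones are bounded uniformly in \<open>\<zeta>\<close> and
  \<open>\<eta>\<close>.\<close>

lemma hamiltonian_energy:
  assumes "\<Lambda> \<in> finite_regions"
  shows "\<bar>hamiltonian U \<Lambda> \<zeta> \<eta> - energy U \<Lambda> \<eta>\<bar> \<le> boundary_norm U \<Lambda>"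
proof -
  let ?\<sigma> = "override_on \<zeta> \<eta> \<Lambda>"
  let ?I = "{A \<in> finite_regions. A \<subseteq> \<Lambda>}"
  let ?B = "{A \<in> finite_regions. A \<inter> \<Lambda> \<noteq> {} \<and> \<not> A \<subseteq> \<Lambda>}"
  have fin: "finite \<Lambda>" using assms by (simp add: finite_regions_def)
  have nB: "(\<lambda>A. norm (U A ?\<sigma>)) summable_on ?B"
  proof (rule Infinite_Sum.abs_summable_on_comparison_test)
    show "(\<lambda>A. norm (interaction_norm U A)) summable_on ?B"
      using summable_boundary[OF fin] by (rule summable_on_iff_abs_summable_on_real[THEN iffD1])
    show "norm (U A ?\<sigma>) \<le> norm (interaction_norm U A)" if "A \<in> ?B" for A
      using le_interaction_norm[of A ?\<sigma>] that by simp
  qed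
  then have sB: "(\<lambda>A. U A ?\<sigma>) summable_on ?B"
    by (rule abs_summable_summable)
  have "{A \<in> finite_regions. A \<inter> \<Lambda> \<noteq> {}} = ?I \<union> ?B"
    by (auto simp: finite_regions_def)
  then have "hamiltonian U \<Lambda> \<zeta> \<eta> = infsum (\<lambda>A. U A ?\<sigma>) (?I \<union> ?B)"
    by (simp add: hamiltonian_def)
  also have "\<dots> = infsum (\<lambda>A. U A ?\<sigma>) ?I + infsum (\<lambda>A. U A ?\<sigma>) ?B"
    using finite_subregions[OF fin] sB by (intro infsum_Un_disjoint) auto
  also have "infsum (\<lambda>A. U A ?\<sigma>) ?I = energy U \<Lambda> ?\<sigma>"
    using finite_subregions[OF fin] by (simp add: energy_def)
  also have "\<dots> = energy U \<Lambda> \<eta>"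
    by (rule energy_cong[OF fin]) (auto simp: fun_eq_iff override_on_def)
  finally have "hamiltonian U \<Lambda> \<zeta> \<eta> - energy U \<Lambda> \<eta> = infsum (\<lambda>A. U A ?\<sigma>) ?B" by simp
  also have "norm \<dots> \<le> infsum (\<lambda>A. norm (U A ?\<sigma>)) ?B"
    by (rule norm_infsum_bound[OF nB])
  also have "\<dots> \<le> boundary_norm U \<Lambda>"
    unfolding boundary_norm_def
    by (rule infsum_mono[OF nB summable_boundary[OF fin]]) (auto intro: le_interaction_norm)
  finally show ?thesis by simp
qed

text \<open>The boundary norm enters twice, once through the numerator and once through the
  normalising sum. The bounds hold for every boundary condition.\<close>

lemma gibbs_weight_bounds:
  assumes "\<Lambda> \<in> finite_regions"
  defines "D \<equiv> boundary_norm U \<Lambda>"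
    and "r \<equiv> (\<lambda>\<zeta> \<eta>. exp (- hamiltonian U \<Lambda> \<zeta> \<eta>) / (\<Sum>\<eta>' \<in> \<Lambda> \<rightarrow>\<^sub>E UNIV. exp (- hamiltonian U \<Lambda> \<zeta> \<eta>')))"
  shows "exp (- 2 * D) * (exp (- energy U \<Lambda> \<eta>) / partition_fn U \<Lambda>) \<le> r \<zeta> \<eta>"
    and "r \<zeta> \<eta> \<le> exp (2 * D) * (exp (- energy U \<Lambda> \<eta>) / partition_fn U \<Lambda>)"
proof -
  have fin: "finite \<Lambda>" using assms by (simp add: finite_regions_def)
  let ?Z = "\<Sum>\<eta>' \<in> \<Lambda> \<rightarrow>\<^sub>E UNIV. exp (- hamiltonian U \<Lambda> \<zeta> \<eta>')"
  have Z: "0 < partition_fn U \<Lambda>" using fin by (rule partition_fn_pos)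
  have Z': "0 < ?Z"
    by (rule sum_pos) (use fin in \<open>auto intro!: finite_PiE simp: PiE_eq_empty_iff\<close>)
  have "\<bar>ln ?Z - ln (partition_fn U \<Lambda>)\<bar> \<le> D"
    unfolding partition_fn_def D_def using fin hamiltonian_energy[OF assms(1)]
    by (intro ln_sum_exp_diff_le) (auto intro!: finite_PiE simp: PiE_eq_empty_iff abs_minus_commute)
  moreover have "\<bar>hamiltonian U \<Lambda> \<zeta> \<eta> - energy U \<Lambda> \<eta>\<bar> \<le> D"
    unfolding D_def by (rule hamiltonian_energy[OF assms(1)])
  moreover have "r \<zeta> \<eta> = exp (- hamiltonian U \<Lambda> \<zeta> \<eta> - ln ?Z)"
    using Z' by (simp add: r_def exp_diff)
  moreover have "exp c * (exp (- energy U \<Lambda> \<eta>) / partition_fn U \<Lambda>) =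
      exp (c - energy U \<Lambda> \<eta> - ln (partition_fn U \<Lambda>))" for c
    using Z by (simp add: exp_diff exp_minus exp_add field_simps)
  ultimately show "exp (- 2 * D) * (exp (- energy U \<Lambda> \<eta>) / partition_fn U \<Lambda>) \<le> r \<zeta> \<eta>"
    and "r \<zeta> \<eta> \<le> exp (2 * D) * (exp (- energy U \<Lambda> \<eta>) / partition_fn U \<Lambda>)"
    by (simp_all only: exp_le_cancel_iff)
qed

end

locale gibbs_field = summable_interaction U + translation_invariant_field P
  for U :: "('a::finite, 'd::finite) interaction" and P :: "('a, 'd) config measure" +
  assumes gibbs: "\<Lambda> \<in> finite_regions \<Longrightarrow> AE \<zeta> in P. \<forall>\<eta> \<in> \<Lambda> \<rightarrow>\<^sub>E UNIV.
        real_cond_exp P (local_field (- \<Lambda>)) (indicator {\<sigma>. restrict \<sigma> \<Lambda> = \<eta>}) \<zeta> =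
          exp (- hamiltonian U \<Lambda> \<zeta> \<eta>) /
            (\<Sum>\<eta>' \<in> \<Lambda> \<rightarrow>\<^sub>E UNIV. exp (- hamiltonian U \<Lambda> \<zeta> \<eta>'))"
begin

text \<open>The probability is the mean of the conditional probability, whose bounds do not depend
  on the boundary condition and therefore survive integration.\<close>

lemma prob_cylinder_bounds:
  fixes \<eta> :: "('a, 'd) config"
  assumes "\<Lambda> \<in> finite_regions"
  defines "g \<equiv> exp (- energy U \<Lambda> \<eta>) / partition_fn U \<Lambda>"
  shows "exp (- 2 * boundary_norm U \<Lambda>) * g \<le> prob (cylinder \<Lambda> \<eta>)"
    and "prob (cylinder \<Lambda> \<eta>) \<le> exp (2 * boundary_norm U \<Lambda>) * g"
proof -
  interpret F: finite_measure_subalgebra P "local_field (- \<Lambda>)"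
    by unfold_locales (rule subalgebra_local_field)
  have fin: "finite \<Lambda>" using assms by (simp add: finite_regions_def)
  \<comment> \<open>The Gibbs property speaks of extensional patterns on \<open>\<Lambda>\<close>,
    whereas \<open>\<eta>\<close> is an arbitrary configuration.\<close>
  have g: "g = exp (- energy U \<Lambda> (restrict \<eta> \<Lambda>)) / partition_fn U \<Lambda>"
    using fin by (simp add: g_def)
  let ?f = "real_cond_exp P (local_field (- \<Lambda>)) (indicator {\<sigma>. restrict \<sigma> \<Lambda> = restrict \<eta> \<Lambda>})"
  have cyl: "{\<sigma>. restrict \<sigma> \<Lambda> = restrict \<eta> \<Lambda>} = cylinder \<Lambda> \<eta>" by (simp add: cylinder_def)
  have int: "integrable P (indicator (cylinder \<Lambda> \<eta>) :: _ \<Rightarrow> real)"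
    using fin by (intro integrable_real_indicator) (auto simp: emeasure_eq_measure)
  have eq: "prob (cylinder \<Lambda> \<eta>) = expectation ?f"
    unfolding cyl by (subst F.real_cond_exp_int(2)[OF int]) simp
  have f: "integrable P ?f"
    unfolding cyl by (rule F.real_cond_exp_int(1)[OF int])
  have AE: "AE \<zeta> in P. ?f \<zeta> =
     exp (- hamiltonian U \<Lambda> \<zeta> (restrict \<eta> \<Lambda>)) / (\<Sum>\<eta>' \<in> \<Lambda> \<rightarrow>\<^sub>E UNIV. exp (- hamiltonian U \<Lambda> \<zeta> \<eta>'))"
    using gibbs[OF assms(1)] by eventually_elim auto
  show "exp (- 2 * boundary_norm U \<Lambda>) * g \<le> prob (cylinder \<Lambda> \<eta>)"
    unfolding eq g
    by (rule integral_ge_const[OF f]) (use AE in eventually_elim, simp only: gibbs_weight_bounds[OF assms(1)])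
  show "prob (cylinder \<Lambda> \<eta>) \<le> exp (2 * boundary_norm U \<Lambda>) * g"
    unfolding eq g
    by (rule integral_le_const[OF f]) (use AE in eventually_elim, simp only: gibbs_weight_bounds[OF assms(1)])
qed

end

lemma gibbs_field_of_gibbs:
  assumes "translation_invariant_interaction U" "translation_invariant_gibbs_field U P"
  shows "gibbs_field U P"
proof -
  have "prob_space P" using assms(2)
    by (simp add: translation_invariant_gibbs_field_def translation_invariant_prob_def)
  then interpret prob_space P .
  show ?thesis
    by unfold_locales
       (use assms in \<open>auto simp: translation_invariant_gibbs_field_def translation_invariant_prob_def\<close>)
qed

section \<open>Moments of hitting times\<close>

lemma enat_powr_enat [simp]: "enat_powr (enat k) r = ennreal (real k powr r)"
  by (simp add: enat_powr_def)

text \<open>The lower bound 1 is essential: \<open>0 powr r\<close> is 0 for every \<open>r\<close>,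
  which breaks monotonicity at 0.\<close>

lemma enat_powr_antimono:
  assumes "r \<le> 0" "1 \<le> v" "v \<le> w"
  shows "enat_powr w r \<le> enat_powr v r"
proof (cases w)
  case (enat l)
  with assms obtain k where k: "v = enat k" by (metis enat_ord_simps(5) enat.exhaust enat_ord_code(3) infinity_ileE)
  with assms enat show ?thesis
    by (auto intro!: ennreal_leI powr_mono2' simp: one_enat_def)
next
  case infinity
  with assms show ?thesis
    by (cases v) (auto simp: enat_powr_def one_enat_def)
qed

lemma enat_powr_mono:
  assumes "0 \<le> r" "v \<le> w"
  shows "enat_powr v r \<le> enat_powr w r"
proof (cases w)
  case (enat l)
  with assms obtain k where k: "v = enat k" by (metis enat_ord_simps(5) enat.exhaust enat_ord_code(3) infinity_ileE)
  with assms enat show ?thesis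
    by (auto intro!: ennreal_leI powr_mono2)
next
  case infinity
  with assms show ?thesis
    by (cases v) (auto simp: enat_powr_def)
qed

lemma powr_nonpos_le_1: "1 \<le> x \<Longrightarrow> a \<le> 0 \<Longrightarrow> x powr a \<le> 1" for x a :: real
  using powr_mono[of a 0 x] by simp

lemma powr_root_power:
  fixes p :: real
  assumes "0 < p" "d \<ge> 1"
  shows "(p powr (- 1 / real d)) ^ d = 1 / p"
proof -
  have "(p powr (- 1 / real d)) ^ d = (p powr (- 1 / real d)) powr real d"
    using assms by (subst powr_realpow) auto
  also have "\<dots> = p powr (- 1)"
    unfolding powr_powr using assms by simp
  finally show ?thesis using assms by (simp add: powr_minus_divide)
qed

text \<open>For 0 < p \<le> 1 this is the larger of \<open>p powr (- q)\<close>, the contribution of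
  typical values of the hitting time, and \<open>p\<close>, the contribution of the value 1. The two
  agree at q = -1.\<close>

definition moment_rate :: "real \<Rightarrow> real \<Rightarrow> real" where
  "moment_rate q p = (if q \<ge> -1 then p powr (- q) else p)"

lemma moment_rate_ge:
  assumes "0 < p" "p \<le> 1"
  shows "p powr (- q) \<le> moment_rate q p" and "q \<le> 0 \<Longrightarrow> p \<le> moment_rate q p"
proof -
  have "p powr (- q) \<le> p powr 1" if "q < -1"
    using assms that by (intro powr_mono') auto
  then show "p powr (- q) \<le> moment_rate q p"
    using assms by (simp add: moment_rate_def)
  have "p powr 1 \<le> p powr (- q)" if "q \<ge> -1"
    using assms that by (intro powr_mono') auto
  then show "p \<le> moment_rate q p"
    using assms by (simp add: moment_rate_def)
qed

lemma summable_powr_exp: "summable (\<lambda>j. (real j + 1) powr s * exp (- real j / 2))"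
proof (rule summable_comparison_test_ev)
  have "\<forall>\<^sub>F j in sequentially. (real j + 1) powr s * exp (- real j / 2) \<le> exp (- real j / 4)"
    by real_asymp
  then show "\<forall>\<^sub>F j in sequentially. norm ((real j + 1) powr s * exp (- real j / 2)) \<le> exp (- 1 / 4) ^ j"
    by eventually_elim (simp add: exp_of_nat_mult[symmetric] mult.commute)
  show "summable (\<lambda>j. exp (- 1 / 4 :: real) ^ j)"
    by (rule summable_geometric) simp
qed

text \<open>Isolates what the moment estimates need from the field. \<open>prob_le\<close> is a
  union bound over the sites searched; \<open>prob_gt\<close> comes from a sublattice of spacing
  \<open>L\<close>, where half of \<open>p\<close> is given up to correlations;
  \<open>prob_1\<close> comes from a single admissible site.\<close>

locale hitting_time = prob_space M for M :: "'b measure" +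
  fixes w :: "'b \<Rightarrow> enat" and p :: real and d L :: nat
  assumes w_measurable [measurable]: "w \<in> M \<rightarrow>\<^sub>M count_space UNIV"
    and w_ge_1: "\<And>x. 1 \<le> w x"
    and p: "0 < p" "p \<le> 1"
    and d: "d \<ge> 1" and L: "L \<ge> 1"
    and prob_le: "\<And>k. prob {x \<in> space M. w x \<le> enat k} \<le> real (k + 1) ^ d * p"
    and prob_gt: "\<And>K. prob {x \<in> space M. w x > enat (L * K)} \<le> exp (- (p / 2) * real K ^ d)"
    and prob_1: "p \<le> prob {x \<in> space M. w x \<le> enat 1}"
begin

text \<open>A cube of this side has at least 1/p sites, the number of trials after which an event of
  probability \<open>p\<close> is to be expected.\<close>

definition mean_scale :: nat where "mean_scale = nat \<lceil>p powr (- 1 / real d)\<rceil>"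

lemma root_ge_1: "1 \<le> p powr (- 1 / real d)"
  using p d by (simp add: powr_minus_divide powr_le1)

lemma mean_scale: "p powr (- 1 / real d) \<le> real mean_scale" "real mean_scale \<le> 2 * p powr (- 1 / real d)" "mean_scale \<ge> 1"
proof -
  show 1: "p powr (- 1 / real d) \<le> real mean_scale"
    unfolding mean_scale_def by linarith
  show "real mean_scale \<le> 2 * p powr (- 1 / real d)"
    unfolding mean_scale_def using root_ge_1 by linarith
  show "mean_scale \<ge> 1"
    using 1 root_ge_1 by linarith
qed

lemma mean_scale_power: "1 / p \<le> real mean_scale ^ d"
proof -
  have "(p powr (- 1 / real d)) ^ d \<le> real mean_scale ^ d"
    by (intro power_mono mean_scale) simp
  then show ?thesis using powr_root_power[OF p(1) d] by simp
qed

lemma powr_root: "(p powr (- 1 / real d)) powr (q * real d) = p powr (- q)"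
  using d by (simp add: powr_powr)

text \<open>With \<open>K = j * mean_scale\<close> in \<open>prob_gt\<close>, the product p * K^d is
  at least j^d and hence at least j.\<close>

lemma prob_gt_multiple: "prob {x \<in> space M. w x > enat (j * (L * mean_scale))} \<le> exp (- real j / 2)"
proof (cases "j = 0")
  case False
  have "real j / p \<le> real j ^ d * real mean_scale ^ d"
  proof -
    have "real j ^ 1 \<le> real j ^ d" using False d by (intro power_increasing) auto
    then have "real j * (1 / p) \<le> real j ^ d * real mean_scale ^ d"
      using mean_scale_power p by (intro mult_mono) auto
    then show ?thesis by simp
  qed
  then have "real j \<le> p * real (j * mean_scale) ^ d"
    using p by (simp add: pos_divide_le_eq power_mult_distrib mult.commute)
  then have "exp (- (p / 2) * real (j * mean_scale) ^ d) \<le> exp (- real j / 2)" by simp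
  then have "prob {x \<in> space M. w x > enat (L * (j * mean_scale))} \<le> exp (- real j / 2)"
    by (rule order_trans[OF prob_gt])
  then show ?thesis by (simp only: mult.left_commute)
qed simp

text \<open>For positive exponents an infinite hitting time contributes \<infinity>; that event lies
  in every tail event and is therefore null.\<close>

lemma AE_finite: "AE x in M. w x \<noteq> \<infinity>"
proof -
  have "prob {x \<in> space M. w x = \<infinity>} \<le> exp (- real j / 2)" for j
    by (rule order_trans[OF finite_measure_mono prob_gt_multiple[of j]]) auto
  moreover have "(\<lambda>j. exp (- real j / 2)) \<longlonglongrightarrow> 0" by real_asymp
  ultimately have "prob {x \<in> space M. w x = \<infinity>} \<le> 0"
    by (intro LIMSEQ_le_const) auto
  then have "prob {x \<in> space M. w x = \<infinity>} = 0"
    by (simp add: measure_le_0_iff)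
  then show ?thesis
    by (subst AE_iff_measurable[OF _ refl]) (auto simp: emeasure_eq_measure)
qed

lemma moment_ge_event:
  assumes "A \<in> events" "\<And>x. x \<in> A \<Longrightarrow> ennreal c \<le> enat_powr (w x) s" "0 \<le> c"
  shows "ennreal (c * prob A) \<le> (\<integral>\<^sup>+ x. enat_powr (w x) s \<partial>M)"
proof -
  have "ennreal (c * prob A) = (\<integral>\<^sup>+ x. ennreal c * indicator A x \<partial>M)"
    using assms by (simp add: nn_integral_cmult_indicator emeasure_eq_measure ennreal_mult)
  also have "\<dots> \<le> (\<integral>\<^sup>+ x. enat_powr (w x) s \<partial>M)"
    by (rule nn_integral_mono) (use assms in \<open>auto simp: indicator_def\<close>)
  finally show ?thesis .
qed

text \<open>At least half of the mass has w \<ge> y. In the constant, 1/2 is that probability, 2^(-q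
  d) comes from the halving in \<open>y\<close> and 2^(-q) from the factor 2 in front of
  \<open>p\<close>. The estimate rests on the union bound, so the constant is free of
  \<open>L\<close>.\<close>

lemma moment_lower_pos:
  assumes "q > 0"
  shows "ennreal (2 powr (- (1 + q * real d + q)) * p powr (- q)) \<le> (\<integral>\<^sup>+ x. enat_powr (w x) (q * real d) \<partial>M)"
proof -
  \<comment> \<open>Chosen so that (2 y)^d * p = 1/2; for y \<ge> 1 the number floor y + 1 is at
    most 2 y, and the union bound gives probability at most 1/2.\<close>
  define y where "y = (2 * p) powr (- 1 / real d) / 2"
  define k where "k = nat \<lfloor>y\<rfloor>"
  let ?A = "{x \<in> space M. w x \<le> enat k}"
  have y: "0 < y" using p by (simp add: y_def)
  have ym: "(2 * y) ^ d = 1 / (2 * p)"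
    using powr_root_power[of "2 * p" d] p d by (simp add: y_def)
  have "prob ?A \<le> 1 / 2"
  proof (cases "y < 1")
    case True
    then have "k = 0" using y by (simp add: k_def floor_eq_iff)
    \<comment> \<open>For y < 1 the estimate k + 1 \<le> 2 y may fail, but then k = 0 and the event
      is empty.\<close>
    have "\<not> w x \<le> enat 0" for x
      using w_ge_1[of x] by (cases "w x") (auto simp: one_enat_def)
    then have A: "?A = {}" by (simp add: \<open>k = 0\<close>)
    show ?thesis unfolding A by simp
  next
    case False
    then have "real (k + 1) \<le> 2 * y" unfolding k_def by linarith
    then have "real (k + 1) ^ d * p \<le> (2 * y) ^ d * p"
      using p by (intro mult_right_mono power_mono) auto
    also have "\<dots> = 1 / 2" unfolding ym using p by simp
    finally show ?thesis using prob_le[of k] by linarith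
  qed
  moreover have "prob (space M - ?A) = 1 - prob ?A"
    by (rule prob_compl) measurable
  ultimately have half: "1 / 2 \<le> prob (space M - ?A)" by simp
  have "ennreal (y powr (q * real d)) \<le> enat_powr (w x) (q * real d)" if "x \<in> space M - ?A" for x
  proof -
    have "ennreal (y powr (q * real d)) \<le> enat_powr (enat (k + 1)) (q * real d)"
      using y assms by (auto intro!: ennreal_leI powr_mono2 simp: k_def) linarith
    also have "\<dots> \<le> enat_powr (w x) (q * real d)"
      using that assms by (intro enat_powr_mono) (auto simp: not_le Suc_ile_eq)
    finally show ?thesis .
  qed
  then have "ennreal (y powr (q * real d) * prob (space M - ?A)) \<le> (\<integral>\<^sup>+ x. enat_powr (w x) (q * real d) \<partial>M)"
    by (intro moment_ge_event) auto
  moreover have "2 powr (- (1 + q * real d + q)) * p powr (- q) \<le> y powr (q * real d) * prob (space M - ?A)"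
  proof -
    have "y powr (q * real d) = ((2 * p) powr (- 1 / real d)) powr (q * real d) / 2 powr (q * real d)"
      unfolding y_def by (simp add: powr_divide)
    also have "((2 * p) powr (- 1 / real d)) powr (q * real d) = (2 * p) powr (- q)"
      using d by (simp add: powr_powr)
    also have "\<dots> = 2 powr (- q) * p powr (- q)"
      using p by (simp add: powr_mult)
    finally have "2 powr (- (1 + q * real d + q)) * p powr (- q) = y powr (q * real d) * (1 / 2)"
      by (simp add: powr_diff powr_minus powr_add field_simps)
    also have "\<dots> \<le> y powr (q * real d) * prob (space M - ?A)"
      using half by (intro mult_left_mono) auto
    finally show ?thesis .
  qed
  ultimately show ?thesis
    by (meson ennreal_leI order_trans)
qed

text \<open>For q \<ge> -1 the typical values of \<open>w\<close> suffice: half of the mass lies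
  below a multiple of p^(-1/d). For q < -1 the event w \<le> 1 alone contributes \<open>p\<close>,
  and the factor with \<open>L\<close>, at most 1, is kept only to give both cases one form.\<close>

lemma moment_lower_nonpos:
  assumes "q \<le> 0"
  shows "ennreal (1 / 2 * (4 * real L) powr (q * real d) * moment_rate q p) \<le> (\<integral>\<^sup>+ x. enat_powr (w x) (q * real d) \<partial>M)"
proof (cases "q \<ge> -1")
  case True
  let ?A = "{x \<in> space M. w x > enat (2 * (L * mean_scale))}"
  have qd: "q * real d \<le> 0" using assms by (simp add: mult_nonpos_nonneg)
  \<comment> \<open>Two units of length are the smallest number for which the tail bound falls below
    1/2.\<close>
  have "prob ?A \<le> exp (- 1)"
    using prob_gt_multiple[of 2] by simp
  also have "exp (- 1 :: real) \<le> 1 / 2"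
    using exp_ge_add_one_self[of "1 :: real"] by (simp add: exp_minus field_simps)
  finally have "prob ?A \<le> 1 / 2" .
  moreover have "prob (space M - ?A) = 1 - prob ?A"
    by (rule prob_compl) measurable
  ultimately have half: "1 / 2 \<le> prob (space M - ?A)" by simp
  have "ennreal (real (2 * (L * mean_scale)) powr (q * real d)) \<le> enat_powr (w x) (q * real d)" if "x \<in> space M - ?A" for x
    using enat_powr_antimono[OF qd w_ge_1, of x "enat (2 * (L * mean_scale))"] that by auto
  then have *: "ennreal (real (2 * (L * mean_scale)) powr (q * real d) * prob (space M - ?A)) \<le> (\<integral>\<^sup>+ x. enat_powr (w x) (q * real d) \<partial>M)"
    by (intro moment_ge_event) auto
  have "1 / 2 * (4 * real L) powr (q * real d) * p powr (- q) = (4 * real L * p powr (- 1 / real d)) powr (q * real d) * (1 / 2)"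
    using powr_root[of q] by (subst powr_mult) simp_all
  also have "\<dots> \<le> real (2 * (L * mean_scale)) powr (q * real d) * prob (space M - ?A)"
  proof (intro mult_mono half powr_mono2' qd)
    show "0 < real (2 * (L * mean_scale))" using L mean_scale(3) by simp
    show "real (2 * (L * mean_scale)) \<le> 4 * real L * p powr (- 1 / real d)"
      using mult_left_mono[OF mean_scale(2), of "2 * real L"] by simp
  qed auto
  finally have "ennreal (1 / 2 * (4 * real L) powr (q * real d) * p powr (- q)) \<le> (\<integral>\<^sup>+ x. enat_powr (w x) (q * real d) \<partial>M)"
    using * by (meson ennreal_leI order_trans)
  then show ?thesis using True by (simp add: moment_rate_def)
next
  case False
  have qd: "q * real d \<le> 0" using assms by (simp add: mult_nonpos_nonneg)
  have "ennreal 1 \<le> enat_powr (w x) (q * real d)" if "x \<in> {x \<in> space M. w x \<le> enat 1}" for x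
    using enat_powr_antimono[OF qd w_ge_1, of x "enat 1"] that by auto
  then have *: "ennreal (1 * prob {x \<in> space M. w x \<le> enat 1}) \<le> (\<integral>\<^sup>+ x. enat_powr (w x) (q * real d) \<partial>M)"
    by (intro moment_ge_event) auto
  have "(4 * real L) powr (q * real d) \<le> 1"
    using L qd by (intro powr_nonpos_le_1) auto
  then have "1 / 2 * (4 * real L) powr (q * real d) * moment_rate q p \<le> 1 * prob {x \<in> space M. w x \<le> enat 1}"
    using prob_1 p False by (intro mult_mono) (auto simp: moment_rate_def)
  then show ?thesis
    using * by (meson ennreal_leI order_trans)
qed

text \<open>The part of the moment with \<open>w\<close> near 2^j is at most 4^d * p * 2^(j (q + 1)
  d). The sign of q + 1 decides whether this is maximal at 2^j near p^(-1/d), with value of order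
  p^(-q), or at j = 0, with value of order p. Bounding every layer by the maximum costs the number
  of layers, at most \<open>1 - log 2 p\<close>, and covers q = -1 without a separate
  argument.\<close>

lemma moment_upper_nonpos:
  assumes "q \<le> 0"
  shows "(\<integral>\<^sup>+ x. enat_powr (w x) (q * real d) \<partial>M) \<le>
    ennreal ((4 ^ d * (1 - log 2 p) + 1) * moment_rate q p)"
proof -
  let ?s = "q * real d"
  let ?y = "p powr (- 1 / real d)"
  define J where "J = nat \<lceil>log 2 ?y\<rceil>"
  have s: "?s \<le> 0" using assms by (simp add: mult_nonpos_nonneg)
  have ly: "0 \<le> log 2 ?y"
    using root_ge_1 by (intro zero_le_log_cancel_iff[THEN iffD2]) auto
  have y: "2 powr (log 2 ?y) = ?y"
    using root_ge_1 by (intro powr_log_cancel) auto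
  have J1: "?y \<le> 2 ^ J"
  proof -
    have "2 powr (log 2 ?y) \<le> 2 powr real J"
      unfolding J_def by (intro powr_mono) linarith+
    then show ?thesis unfolding y by (simp add: powr_realpow)
  qed
  have J2: "2 ^ j \<le> ?y" if "j < J" for j
  proof -
    have "real j \<le> log 2 ?y" using that ly unfolding J_def by linarith
    then have "2 powr real j \<le> 2 powr (log 2 ?y)" by (intro powr_mono) auto
    then show ?thesis unfolding y by (simp add: powr_realpow)
  qed
  have J3: "real J \<le> 1 - log 2 p"
  proof -
    have "log 2 ?y = - log 2 p / real d" using p by (simp add: log_powr)
    also have "\<dots> \<le> - log 2 p / 1"
      using p d by (intro divide_left_mono) auto
    finally show ?thesis using ly unfolding J_def by linarith
  qed
  \<comment> \<open>Dyadic layers below the scale \<open>2 ^ J\<close>, beyond which \<open>w powr s\<close> is already as small as required.\<close>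
  let ?f = "\<lambda>x. (\<Sum>j<J. ennreal ((2 ^ j) powr ?s) * indicator {x \<in> space M. w x \<le> enat (2 ^ (j + 1))} x) + ennreal ((2 ^ J) powr ?s)"
  have pointwise: "enat_powr (w x) ?s \<le> ?f x" if x: "x \<in> space M" for x
  proof (cases "enat (2 ^ J) \<le> w x")
    case True
    have "enat_powr (w x) ?s \<le> enat_powr (enat (2 ^ J)) ?s"
      by (rule enat_powr_antimono[OF s _ True]) (simp add: one_enat_def)
    then show ?thesis by (simp add: add_increasing)
  next
    case False
    then obtain k where k: "w x = enat k" "k < 2 ^ J" by (cases "w x") auto
    have k1: "k \<ge> 1" using w_ge_1[of x] k by (simp add: one_enat_def)
    obtain j where j: "2 ^ j \<le> k" "k < 2 ^ (j + 1)"
      using ex_power_ivl1[of 2 k] k1 by auto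
    have "(2 :: nat) ^ j < 2 ^ J" using j(1) k(2) by (rule le_less_trans)
    then have jJ: "j < J" by simp
    have "enat_powr (w x) ?s \<le> enat_powr (enat (2 ^ j)) ?s"
      by (rule enat_powr_antimono[OF s]) (use k j in \<open>auto simp: one_enat_def\<close>)
    also have "\<dots> = ennreal ((2 ^ j) powr ?s) * indicator {x \<in> space M. w x \<le> enat (2 ^ (j + 1))} x"
      using x k j by simp
    also have "\<dots> \<le> (\<Sum>j<J. ennreal ((2 ^ j) powr ?s) * indicator {x \<in> space M. w x \<le> enat (2 ^ (j + 1))} x)"
      by (rule member_le_sum[where f = "\<lambda>j. ennreal ((2 ^ j) powr ?s) * indicator {x \<in> space M. w x \<le> enat (2 ^ (j + 1))} x"])
         (use jJ in auto)
    also have "\<dots> \<le> ?f x" by simp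
    finally show ?thesis .
  qed
  have layer: "(2 ^ j) powr ?s * prob {x \<in> space M. w x \<le> enat (2 ^ (j + 1))} \<le> 4 ^ d * moment_rate q p"
    if "j < J" for j
  proof -
    have "(1 :: real) \<le> 2 ^ j" by (rule one_le_power) simp
    then have "real (2 ^ (j + 1) + 1) \<le> 4 * 2 ^ j"
      unfolding of_nat_add of_nat_power power_add of_nat_mult of_nat_numeral of_nat_1 power_one_right by linarith
    then have "real (2 ^ (j + 1) + 1) ^ d \<le> (4 * 2 ^ j) ^ d" by (intro power_mono) auto
    then have "prob {x \<in> space M. w x \<le> enat (2 ^ (j + 1))} \<le> (4 * 2 ^ j) ^ d * p"
      using prob_le[of "2 ^ (j + 1)"] p by (meson mult_right_mono order_trans less_imp_le)
    then have "(2 ^ j) powr ?s * prob {x \<in> space M. w x \<le> enat (2 ^ (j + 1))} \<le> (2 ^ j) powr ?s * ((4 * 2 ^ j) ^ d * p)"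
      by (intro mult_left_mono) auto
    also have "\<dots> = 4 ^ d * ((2 ^ j) powr (?s + real d) * p)"
      by (simp add: powr_add powr_realpow power_mult_distrib)
    also have "(2 ^ j) powr (?s + real d) * p \<le> moment_rate q p"
    proof (cases "q \<ge> -1")
      case True
      have "0 \<le> (q + 1) * real d" using True by simp
      then have "(2 ^ j) powr (?s + real d) \<le> ?y powr (?s + real d)"
        using J2[OF that] by (intro powr_mono2) (auto simp: algebra_simps)
      also have "?y powr (?s + real d) = p powr (- q - 1)"
        using powr_root[of "q + 1"]
        by (simp only: distrib_right mult_1 minus_add_distrib diff_conv_add_uminus)
      finally have "(2 ^ j) powr (?s + real d) * p \<le> p powr (- q - 1) * p"
        using p by (intro mult_right_mono) auto
      also have "\<dots> = p powr (- q)" using p by (simp add: powr_diff)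
      finally show ?thesis using True by (simp add: moment_rate_def)
    next
      case False
      have "(q + 1) * real d \<le> 0" using False by (intro mult_nonpos_nonneg) auto
      then have "(2 ^ j) powr (?s + real d) \<le> (1 :: real)"
        by (intro powr_nonpos_le_1) (auto simp: algebra_simps)
      then show ?thesis using False p by (simp add: moment_rate_def mult_left_le_one_le)
    qed
    finally show ?thesis by simp
  qed
  have last: "(2 ^ J) powr ?s \<le> moment_rate q p"
  proof -
    have "(2 ^ J) powr ?s \<le> ?y powr ?s"
      using J1 s root_ge_1 by (intro powr_mono2') auto
    also have "\<dots> = p powr (- q)" by (rule powr_root)
    also have "\<dots> \<le> moment_rate q p" by (rule moment_rate_ge[OF p])
    finally show ?thesis .
  qed
  have "(\<integral>\<^sup>+ x. enat_powr (w x) ?s \<partial>M) \<le> (\<integral>\<^sup>+ x. ?f x \<partial>M)"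
    by (rule nn_integral_mono) (rule pointwise)
  also have "\<dots> = (\<Sum>j<J. ennreal ((2 ^ j) powr ?s) * ennreal (prob {x \<in> space M. w x \<le> enat (2 ^ (j + 1))})) + ennreal ((2 ^ J) powr ?s)"
  proof -
    define h where "h j x = ennreal ((2 ^ j) powr ?s) * indicator {x \<in> space M. w x \<le> enat (2 ^ (j + 1))} x" for j x
    have [measurable]: "h j \<in> borel_measurable M" for j
      unfolding h_def by measurable
    have "(\<integral>\<^sup>+ x. h j x \<partial>M) = ennreal ((2 ^ j) powr ?s) * ennreal (prob {x \<in> space M. w x \<le> enat (2 ^ (j + 1))})" for j
      unfolding h_def by (subst nn_integral_cmult_indicator) (auto simp: emeasure_eq_measure)
    moreover have "(\<integral>\<^sup>+ x. (\<Sum>j<J. h j x) + ennreal ((2 ^ J) powr ?s) \<partial>M) =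
      (\<Sum>j<J. \<integral>\<^sup>+ x. h j x \<partial>M) + ennreal ((2 ^ J) powr ?s)"
      by (simp add: nn_integral_add nn_integral_sum emeasure_space_1)
    ultimately show ?thesis by (simp only: h_def)
  qed
  also have "\<dots> = ennreal ((\<Sum>j<J. (2 ^ j) powr ?s * prob {x \<in> space M. w x \<le> enat (2 ^ (j + 1))}) + (2 ^ J) powr ?s)"
    by (simp add: ennreal_mult[symmetric] sum_nonneg sum_ennreal flip: ennreal_plus)
  also have "\<dots> \<le> ennreal ((4 ^ d * (1 - log 2 p) + 1) * moment_rate q p)"
  proof (rule ennreal_leI)
    have mr: "0 \<le> moment_rate q p" using p by (simp add: moment_rate_def)
    have "(\<Sum>j<J. (2 ^ j) powr ?s * prob {x \<in> space M. w x \<le> enat (2 ^ (j + 1))}) \<le> (\<Sum>j<J. 4 ^ d * moment_rate q p)"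
      by (rule sum_mono) (use layer in auto)
    also have "\<dots> = real J * (4 ^ d * moment_rate q p)" by simp
    also have "\<dots> \<le> (1 - log 2 p) * (4 ^ d * moment_rate q p)"
      using J3 mr by (intro mult_right_mono) auto
    finally show "(\<Sum>j<J. (2 ^ j) powr ?s * prob {x \<in> space M. w x \<le> enat (2 ^ (j + 1))}) + (2 ^ J) powr ?s
      \<le> (4 ^ d * (1 - log 2 p) + 1) * moment_rate q p"
      using last by (simp add: algebra_simps)
  qed
  finally show ?thesis .
qed

text \<open>The values of \<open>w\<close> are cut into blocks of length
  \<open>L * mean_scale\<close>; the exponential decay of the tail over blocks beats the polynomial
  growth of the power, leaving a convergent series independent of \<open>p\<close>.\<close>

lemma moment_upper_pos:
  assumes "q > 0"
  defines "s \<equiv> q * real d"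
  shows "(\<integral>\<^sup>+ x. enat_powr (w x) s \<partial>M) \<le>
    ennreal ((\<Sum>j. (real j + 1) powr s * exp (- real j / 2)) * (2 * real L) powr s * p powr (- q))"
proof -
  let ?N = "L * mean_scale"
  let ?c = "\<lambda>j. (real j + 1) powr s"
  have N: "?N \<ge> 1" using L mean_scale(3) by simp
  have s: "0 < s" using assms d by (simp add: s_def)
  have "(\<integral>\<^sup>+ x. enat_powr (w x) s \<partial>M) \<le>
    (\<integral>\<^sup>+ x. (\<Sum>j. ennreal (?c j * real ?N powr s) * indicator {x \<in> space M. w x > enat (j * ?N)} x) \<partial>M)"
  proof (rule nn_integral_mono_AE, use AE_finite AE_space in eventually_elim)
    case (elim x)
    then obtain k where k: "w x = enat k" by auto
    have k1: "k \<ge> 1" using w_ge_1[of x] k by (simp add: one_enat_def)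
    \<comment> \<open>With k - 1 in place of k, a multiple of \<open>?N\<close> belongs to the block
      that it ends; the strict lower inequality is the one in the tail event.\<close>
    define j where "j = (k - 1) div ?N"
    have j1: "j * ?N < k"
    proof -
      have "j * ?N \<le> k - 1" unfolding j_def by (rule div_times_less_eq_dividend)
      with k1 show ?thesis by linarith
    qed
    have j2: "k \<le> (j + 1) * ?N"
    proof -
      have "k - 1 < (j + 1) * ?N" unfolding j_def using N
        by (metis Suc_eq_plus1 dividend_less_div_times mult.commute mult_Suc_right less_le_trans zero_less_one add.commute mult_Suc)
      with k1 show ?thesis by linarith
    qed
    have "real k powr s \<le> real ((j + 1) * ?N) powr s"
      using s j2 by (intro powr_mono2) (auto simp del: of_nat_mult of_nat_add)
    also have "\<dots> = ?c j * real ?N powr s"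
      unfolding of_nat_mult[of "j + 1"] by (subst powr_mult) (auto simp: add.commute)
    finally have *: "real k powr s \<le> ?c j * real ?N powr s" .
    define h where "h j = ennreal (?c j * real ?N powr s) * indicator {x \<in> space M. w x > enat (j * ?N)} x" for j
    have "enat_powr (w x) s \<le> h j"
      using k j1 elim * by (simp add: h_def ennreal_leI del: of_nat_mult)
    also have "h j \<le> (\<Sum>j. h j)"
      using sum_le_suminf[of h "{j}"] by simp
    finally show ?case by (simp only: h_def)
  qed
  also have "\<dots> = (\<Sum>j. ennreal (?c j * real ?N powr s) * ennreal (prob {x \<in> space M. w x > enat (j * ?N)}))"
    by (subst nn_integral_suminf) (auto simp: nn_integral_cmult_indicator emeasure_eq_measure)
  also have "\<dots> \<le> (\<Sum>j. ennreal (real ?N powr s * (?c j * exp (- real j / 2))))"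
  proof (rule suminf_le)
    fix j
    show "ennreal (?c j * real ?N powr s) * ennreal (prob {x \<in> space M. w x > enat (j * ?N)})
      \<le> ennreal (real ?N powr s * (?c j * exp (- real j / 2)))"
      using mult_left_mono[OF prob_gt_multiple[of j], of "?c j * real ?N powr s"]
      by (simp add: ennreal_mult[symmetric] mult_ac ennreal_leI)
  qed auto
  also have "\<dots> = ennreal (\<Sum>j. real ?N powr s * (?c j * exp (- real j / 2)))"
    by (rule suminf_ennreal2, simp) (intro summable_mult summable_powr_exp)
  also have "(\<Sum>j. real ?N powr s * (?c j * exp (- real j / 2))) = real ?N powr s * (\<Sum>j. ?c j * exp (- real j / 2))"
    by (rule suminf_mult) (rule summable_powr_exp)
  also have "ennreal \<dots> \<le> ennreal ((2 * real L) powr s * p powr (- q) * (\<Sum>j. ?c j * exp (- real j / 2)))"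
  proof (intro ennreal_leI mult_right_mono suminf_nonneg summable_powr_exp)
    have "real ?N powr s \<le> (2 * real L * p powr (- 1 / real d)) powr s"
    proof (rule powr_mono2)
      show "real ?N \<le> 2 * real L * p powr (- 1 / real d)"
        using mult_left_mono[OF mean_scale(2), of "real L"] by simp
    qed (use s in auto)
    also have "\<dots> = (2 * real L) powr s * p powr (- q)"
      unfolding s_def using powr_root[of q] by (subst powr_mult) simp_all
    finally show "real ?N powr s \<le> (2 * real L) powr s * p powr (- q)" .
  qed auto
  finally show ?thesis by (simp add: mult_ac)
qed

end

section \<open>Occurrence of patterns in mixing fields\<close>

definition occurrence :: "nat \<Rightarrow> ('a, 'd::finite) config \<Rightarrow> int ^ 'd \<Rightarrow> ('a, 'd) config set" where
  "occurrence n \<eta> x = {\<sigma>. restrict (shift x \<sigma>) (cube n) = restrict \<eta> (cube n)}"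

lemma occurrence_eq_vimage: "occurrence n \<eta> x = shift x -` cylinder (cube n) \<eta>"
  by (simp add: occurrence_def cylinder_def vimage_def)

text \<open>The two descriptions of an occurrence serve different ends: the preimage under a shift
  yields its probability, the cylinder over the translated cube yields its locality.\<close>

lemma occurrence_eq_cylinder:
  "occurrence n \<eta> x = cylinder ((\<lambda>y. y + x) ` cube n) (shift (- x) \<eta>)"
proof -
  have "restrict (shift x \<sigma>) (cube n) = restrict \<eta> (cube n) \<longleftrightarrow> (\<forall>y\<in>cube n. \<sigma> (x + y) = \<eta> y)" for \<sigma>
    by (auto simp: fun_eq_iff shift_def restrict_def)
  moreover have "restrict \<sigma> ((\<lambda>y. y + x) ` cube n) = restrict (shift (- x) \<eta>) ((\<lambda>y. y + x) ` cube n)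
    \<longleftrightarrow> (\<forall>y\<in>cube n. \<sigma> (x + y) = \<eta> y)" for \<sigma>
    by (auto simp: fun_eq_iff shift_def restrict_def add.commute)
  ultimately show ?thesis by (auto simp: occurrence_def cylinder_def)
qed

lemma occurrence_local: "occurrence n \<eta> x \<in> sets (local_field ((\<lambda>y. y + x) ` cube n))"
  unfolding occurrence_eq_cylinder by (rule cylinder_in_local_field) simp

text \<open>An infimum of a nonempty set of extended naturals is attained, and the condition on
  \<open>k\<close> is monotone; for the empty set the infimum is \<infinity>.\<close>

lemma waiting_time_le_iff:
  "waiting_time n \<eta> \<sigma> \<le> enat k \<longleftrightarrow>
    (\<exists>x. l1norm x > 0 \<and> (\<forall>i. 0 \<le> x $ i \<and> x $ i \<le> int k) \<and> \<sigma> \<in> occurrence n \<eta> x)"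
proof -
  let ?S = "{k. \<exists>x. l1norm x > 0 \<and> (\<forall>i. 0 \<le> x $ i \<and> x $ i \<le> int k) \<and>
                      restrict (shift x \<sigma>) (cube n) = restrict \<eta> (cube n)}"
  have "Inf (enat ` ?S) \<le> enat k \<longleftrightarrow> k \<in> ?S"
  proof
    assume le: "Inf (enat ` ?S) \<le> enat k"
    have "enat ` ?S \<noteq> {}"
    proof
      assume e: "enat ` ?S = {}"
      show False using le unfolding e by (simp add: top_enat_def)
    qed
    then obtain x where "x \<in> enat ` ?S" by blast
    then have "Inf (enat ` ?S) \<in> enat ` ?S" by (rule wellorder_InfI)
    then obtain k' where k': "k' \<in> ?S" "enat k' \<le> enat k" using le by force
    from k'(1) obtain x where x: "l1norm x > 0" "\<And>i. 0 \<le> x $ i \<and> x $ i \<le> int k'"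
      "restrict (shift x \<sigma>) (cube n) = restrict \<eta> (cube n)" by blast
    have le: "x $ i \<le> int k" for i using x(2)[of i] k'(2) by simp
    show "k \<in> ?S"
      unfolding mem_Collect_eq using x le by (intro exI[of _ x] conjI allI) simp_all
  next
    assume "k \<in> ?S"
    then show "Inf (enat ` ?S) \<le> enat k" by (intro Inf_lower) auto
  qed
  then show ?thesis
    by (simp add: waiting_time_def occurrence_def)
qed

lemma l1norm_pos: "l1norm x > 0 \<longleftrightarrow> (\<exists>i. x $ i \<noteq> 0)"
proof -
  have "l1norm x = 0 \<longleftrightarrow> (\<forall>i. x $ i = 0)"
    unfolding l1norm_def by (subst sum_nonneg_eq_0_iff) auto
  moreover have "l1norm x \<ge> 0"
    unfolding l1norm_def by (rule sum_nonneg) simp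
  ultimately show ?thesis by (metis order_le_less order_less_irrefl)
qed

lemma component_le_l1norm: "\<bar>x $ i\<bar> \<le> l1norm x"
  unfolding l1norm_def by (rule member_le_sum) auto

lemma waiting_time_ge_1: "1 \<le> waiting_time n \<eta> \<sigma>" for \<sigma> :: "('a, 'd::finite) config"
proof (rule ccontr)
  assume "\<not> 1 \<le> waiting_time n \<eta> \<sigma>"
  then have "waiting_time n \<eta> \<sigma> \<le> enat 0"
    by (cases "waiting_time n \<eta> \<sigma>") (auto simp: one_enat_def)
  then obtain x :: "int ^ 'd" and i where "x $ i \<noteq> 0" "0 \<le> x $ i" "x $ i \<le> int 0"
    unfolding waiting_time_le_iff l1norm_pos by blast
  then show False by simp
qed

lemma waiting_time_le_eq:
  "{\<sigma>. waiting_time n \<eta> \<sigma> \<le> enat k} = (\<Union>x\<in>{x \<in> int_box 0 (int k). l1norm x > 0}. occurrence n \<eta> x)"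
  by (auto simp: waiting_time_le_iff int_box_def)

lemma region_dist_ge:
  assumes "finite A" "finite B" "A \<noteq> {}" "B \<noteq> {}"
    and "\<And>x y. x \<in> A \<Longrightarrow> y \<in> B \<Longrightarrow> m \<le> l1norm (x - y)"
  shows "m \<le> region_dist A B"
proof -
  have "{l1norm (x - y) |x y. x \<in> A \<and> y \<in> B} = (\<lambda>(x, y). l1norm (x - y)) ` (A \<times> B)" by auto
  then show ?thesis
    unfolding region_dist_def using assms by (subst Min_ge_iff) auto
qed

text \<open>Points of one cube differ by at most n in each coordinate, so a spacing of n + m leaves
  at least m in a coordinate where the indices differ.\<close>

lemma grid_distance:
  assumes "y \<in> cube n" "y' \<in> cube n" "j \<noteq> j'"
  shows "int m \<le> l1norm ((y + int (n + m) *s j) - (y' + int (n + m) *s j'))"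
proof -
  obtain i where i: "j $ i \<noteq> j' $ i" using assms(3) by (auto simp: vec_eq_iff)
  have "int (n + m) * 1 \<le> int (n + m) * \<bar>j $ i - j' $ i\<bar>"
    using i by (intro mult_left_mono) auto
  also have "\<dots> = \<bar>int (n + m) * (j $ i - j' $ i)\<bar>"
    by (simp add: abs_mult)
  also have "int (n + m) * (j $ i - j' $ i) =
     ((y + int (n + m) *s j) - (y' + int (n + m) *s j')) $ i - (y $ i - y' $ i)"
    by (simp add: algebra_simps)
  finally have "int (n + m) * 1 \<le> \<bar>((y + int (n + m) *s j) - (y' + int (n + m) *s j')) $ i - (y $ i - y' $ i)\<bar>" .
  also have "\<dots> \<le> \<bar>((y + int (n + m) *s j) - (y' + int (n + m) *s j')) $ i\<bar> + \<bar>y $ i - y' $ i\<bar>"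
    by (rule abs_triangle_ineq4)
  finally have "int n + int m \<le> \<bar>((y + int (n + m) *s j) - (y' + int (n + m) *s j')) $ i\<bar> + \<bar>y $ i - y' $ i\<bar>"
    by (simp only: mult_1_right of_nat_add)
  moreover have "\<bar>y $ i - y' $ i\<bar> \<le> int n"
    using assms(1,2) by (simp add: cube_def abs_le_iff) (metis add_increasing2 add_mono diff_add_cancel diff_left_mono diff_zero order_trans)
  ultimately have "int m \<le> \<bar>((y + int (n + m) *s j) - (y' + int (n + m) *s j')) $ i\<bar>" by linarith
  then show ?thesis using component_le_l1norm order_trans by blast
qed

context translation_invariant_field begin

lemma occurrence_events [measurable]: "occurrence n \<eta> x \<in> events"
  using local_field_events[OF occurrence_local] .

lemma prob_occurrence: "prob (occurrence n \<eta> x) = prob (cylinder (cube n) \<eta>)"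
  unfolding occurrence_eq_vimage by (rule prob_shift) (simp add: cylinder_events)

lemma waiting_time_le_events [measurable]: "{\<sigma>. waiting_time n \<eta> \<sigma> \<le> enat k} \<in> events"
proof -
  have "finite {x \<in> int_box 0 (int k) :: (int ^ 'd) set. l1norm x > 0}" by simp
  then show ?thesis unfolding waiting_time_le_eq by (intro sets.finite_UN) auto
qed

lemma waiting_time_measurable [measurable]: "waiting_time n \<eta> \<in> P \<rightarrow>\<^sub>M count_space UNIV"
proof (rule measurable_count_space_eq2_countable[THEN iffD2], safe)
  fix v
  let ?E = "\<lambda>k. {\<sigma>. waiting_time n \<eta> \<sigma> \<le> enat k}"
  have "waiting_time n \<eta> -` {v} \<inter> space P =
    (case v of enat k \<Rightarrow> ?E k - (\<Union>j<k. ?E j) | \<infinity> \<Rightarrow> UNIV - (\<Union>j. ?E j))"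
  proof (cases v)
    case (enat k)
    have "waiting_time n \<eta> \<sigma> = enat k \<longleftrightarrow> waiting_time n \<eta> \<sigma> \<le> enat k \<and> (\<forall>j<k. \<not> waiting_time n \<eta> \<sigma> \<le> enat j)" for \<sigma>
      by (cases "waiting_time n \<eta> \<sigma>") (auto simp: not_le, metis less_irrefl not_less_iff_gr_or_eq order_le_less)
    then show ?thesis by (auto simp: enat)
  next
    case infinity
    have "waiting_time n \<eta> \<sigma> = \<infinity> \<longleftrightarrow> (\<forall>j. \<not> waiting_time n \<eta> \<sigma> \<le> enat j)" for \<sigma>
      by (cases "waiting_time n \<eta> \<sigma>") auto
    then show ?thesis by (auto simp: infinity)
  qed
  also have "\<dots> \<in> events"
    by (cases v) (auto intro!: sets.Diff sets.finite_UN sets.countable_UN, metis sets.top space_P)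
  finally show "waiting_time n \<eta> -` {v} \<inter> space P \<in> events" .
qed auto

text \<open>Union bound over the positions; by translation invariance all of them have the same
  probability.\<close>

lemma prob_waiting_time_le:
  "prob {\<sigma>. waiting_time n \<eta> \<sigma> \<le> enat k} \<le> real (k + 1) ^ CARD('d) * prob (cylinder (cube n) \<eta>)"
proof -
  let ?X = "{x \<in> int_box 0 (int k) :: (int ^ 'd) set. l1norm x > 0}"
  have "prob {\<sigma>. waiting_time n \<eta> \<sigma> \<le> enat k} \<le> (\<Sum>x\<in>?X. prob (occurrence n \<eta> x))"
    unfolding waiting_time_le_eq by (rule finite_measure_subadditive_finite) auto
  also have "\<dots> = real (card ?X) * prob (cylinder (cube n) \<eta>)"
    by (simp add: prob_occurrence)
  also have "\<dots> \<le> real (k + 1) ^ CARD('d) * prob (cylinder (cube n) \<eta>)"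
  proof (rule mult_right_mono)
    have "card ?X \<le> card (int_box 0 (int k) :: (int ^ 'd) set)"
      by (rule card_mono) auto
    also have "\<dots> = (k + 1) ^ CARD('d)" by (simp add: card_int_box nat_add_distrib)
    finally show "real (card ?X) \<le> real (k + 1) ^ CARD('d)"
      by (metis of_nat_le_iff of_nat_power)
  qed simp
  finally show ?thesis .
qed

lemma prob_waiting_time_le_1:
  "prob (cylinder (cube n) \<eta>) \<le> prob {\<sigma>. waiting_time n \<eta> \<sigma> \<le> enat 1}"
proof -
  \<comment> \<open>Any nonzero vector with coordinates in {0, 1} would serve.\<close>
  let ?x = "(\<chi> i. 1) :: int ^ 'd"
  have "prob (occurrence n \<eta> ?x) \<le> prob {\<sigma>. waiting_time n \<eta> \<sigma> \<le> enat 1}"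
  proof (rule finite_measure_mono)
    have "l1norm ?x > 0" by (simp add: l1norm_pos)
    then show "occurrence n \<eta> ?x \<subseteq> {\<sigma>. waiting_time n \<eta> \<sigma> \<le> enat 1}"
      unfolding waiting_time_le_iff by auto
  qed simp
  then show ?thesis by (simp add: prob_occurrence)
qed

end

section \<open>Mixing and the absence of a pattern\<close>

locale mixing_field = translation_invariant_field P
  for P :: "('a::finite, 'd::finite) config measure" +
  fixes C1 C2 :: real
  assumes C1: "C1 > 0" and C2: "C2 > 0"
    and mixing: "\<And>m. m > 0 \<Longrightarrow> phi_mix P m \<le> C1 * exp (- C2 * m)"
begin

text \<open>Turns the supremum in \<open>phi_mix\<close> into an inequality for given events. This
  requires the set under the supremum to be bounded; 1 is a bound, because differences of
  probabilities are at most 1 and regions have at least one site.\<close>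

lemma mixing_bound:
  assumes A: "A1 \<in> finite_regions" "A2 \<in> finite_regions"
    and m: "0 < m" "m \<le> real_of_int (region_dist A1 A2)"
    and E: "E1 \<in> sets (local_field A1)" "E2 \<in> sets (local_field A2)"
  shows "prob (E1 \<inter> E2) \<le> (prob E1 + real (card A1) * (C1 * exp (- C2 * m))) * prob E2"
proof (cases "prob E2 > 0")
  case False
  then have "prob E2 = 0" by (simp add: order_less_le)
  moreover have "prob (E1 \<inter> E2) \<le> prob E2"
    using local_field_events E by (intro finite_measure_mono) auto
  ultimately show ?thesis by simp
next
  case True
  let ?v = "\<lambda>A1 E1 E2. 1 / real (card A1) * \<bar>cond_prob P (\<lambda>\<sigma>. \<sigma> \<in> E1) (\<lambda>\<sigma>. \<sigma> \<in> E2) - prob E1\<bar>"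
  let ?S = "{?v A1 E1 E2 | A1 A2 E1 E2.
            A1 \<in> finite_regions \<and> A2 \<in> finite_regions \<and> m \<le> real_of_int (region_dist A1 A2) \<and>
            E1 \<in> sets (local_field A1) \<and> E2 \<in> sets (local_field A2) \<and> measure P E2 > 0}"
  have cp: "cond_prob P (\<lambda>\<sigma>. \<sigma> \<in> E1) (\<lambda>\<sigma>. \<sigma> \<in> E2) = prob (E1 \<inter> E2) / prob E2" for E1 E2
    by (simp add: cond_prob_def Int_def)
  have "bdd_above ?S"
  proof (rule bdd_aboveI[of _ 1])
    fix t assume "t \<in> ?S"
    then obtain B1 B2 F1 F2 where B: "B1 \<in> finite_regions" "F1 \<in> sets (local_field B1)"
      "F2 \<in> sets (local_field B2)" "prob F2 > 0" and t: "t = ?v B1 F1 F2" by blast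
    have "prob (F1 \<inter> F2) \<le> prob F2"
      using local_field_events B by (intro finite_measure_mono) auto
    then have "prob (F1 \<inter> F2) / prob F2 \<le> 1" "0 \<le> prob (F1 \<inter> F2) / prob F2"
      using B(4) by (auto simp: divide_le_eq)
    then have a: "\<bar>prob (F1 \<inter> F2) / prob F2 - prob F1\<bar> \<le> 1"
      using prob_le_1[of F1] measure_nonneg[of P F1] unfolding abs_le_iff by linarith
    have "1 \<le> card B1" using B(1) by (simp add: finite_regions_def card_gt_0_iff Suc_leI)
    then have "1 / real (card B1) \<le> 1" by simp
    then have "t \<le> 1 * 1" unfolding t cp using a by (intro mult_mono) auto
    then show "t \<le> 1" by simp
  qed
  moreover have "?v A1 E1 E2 \<in> ?S" using A m E True by blast
  ultimately have "?v A1 E1 E2 \<le> Sup ?S" by (intro cSup_upper)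
  also have "Sup ?S = phi_mix P m" by (simp add: phi_mix_def)
  also have "\<dots> \<le> C1 * exp (- C2 * m)" by (rule mixing[OF m(1)])
  finally have le: "?v A1 E1 E2 \<le> C1 * exp (- C2 * m)" .
  have c: "real (card A1) > 0" using A(1) by (simp add: finite_regions_def card_gt_0_iff)
  from le c have "\<bar>prob (E1 \<inter> E2) / prob E2 - prob E1\<bar> \<le> real (card A1) * (C1 * exp (- C2 * m))"
    unfolding cp by (simp add: divide_le_eq mult.commute)
  then have "prob (E1 \<inter> E2) / prob E2 \<le> prob E1 + real (card A1) * (C1 * exp (- C2 * m))"
    by linarith
  then show ?thesis using True by (simp only: pos_divide_le_eq)
qed

text \<open>Translates are added one by one. The new one takes the role of \<open>A1\<close>, so the
  error is always that of a single cube, however many translates are already present; each step thus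
  contributes a factor of at most 1 - p + p/2.\<close>

lemma prob_no_occurrence:
  assumes "finite J" "m \<ge> 1"
    and small: "real ((n + 1) ^ CARD('d)) * (C1 * exp (- C2 * real m)) \<le> prob (cylinder (cube n) \<eta>) / 2"
  shows "prob (UNIV - (\<Union>j\<in>J. occurrence n \<eta> (int (n + m) *s j))) \<le>
    (1 - prob (cylinder (cube n) \<eta>) / 2) ^ card J"
  using assms(1)
proof (induction J)
  case empty
  then show ?case by simp
next
  case (insert j J)
  let ?p = "prob (cylinder (cube n) \<eta>)"
  let ?x = "\<lambda>j. int (n + m) *s j"
  let ?E1 = "UNIV - occurrence n \<eta> (?x j)"
  let ?E2 = "UNIV - (\<Union>j\<in>J. occurrence n \<eta> (?x j))"
  let ?A1 = "(\<lambda>y. y + ?x j) ` (cube n :: (int ^ 'd) set)"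
  let ?A2 = "\<Union>j\<in>J. (\<lambda>y. y + ?x j) ` (cube n :: (int ^ 'd) set)"
  have p1: "prob ?E1 = 1 - ?p"
    using prob_compl[OF occurrence_events, of n \<eta> "?x j"] by (simp add: prob_occurrence)
  have eq: "UNIV - (\<Union>j\<in>insert j J. occurrence n \<eta> (?x j)) = ?E1 \<inter> ?E2" by auto
  \<comment> \<open>The first translate is treated apart, since mixing compares nonempty
    regions.\<close>
  have "prob (?E1 \<inter> ?E2) \<le> (1 - ?p / 2) * prob ?E2"
  proof (cases "J = {}")
    case True
    then show ?thesis using p1 prob_space by (simp add: space_P[symmetric] del: space_P)
  next
    case False
    have ne: "(cube n :: (int ^ 'd) set) \<noteq> {}" using zero_in_cube by blast
    have A: "?A1 \<in> finite_regions" "?A2 \<in> finite_regions"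
      using False insert.hyps(1) ne by (auto simp: finite_regions_def)
    have "int m \<le> region_dist ?A1 ?A2"
    proof (rule region_dist_ge)
      fix x y assume "x \<in> ?A1" "y \<in> ?A2"
      then obtain z z' j' where "x = z + ?x j" "y = z' + ?x j'" "z \<in> cube n" "z' \<in> cube n" "j' \<in> J" by auto
      then show "int m \<le> l1norm (x - y)"
        using grid_distance insert.hyps(2) by metis
    qed (use A in \<open>auto simp: finite_regions_def\<close>)
    then have m: "real m \<le> real_of_int (region_dist ?A1 ?A2)" by linarith
    have E1: "?E1 \<in> sets (local_field ?A1)"
      using sets.compl_sets[OF occurrence_local[of n \<eta> "?x j"]] by simp
    have "occurrence n \<eta> (?x j) \<in> sets (local_field ?A2)" if "j \<in> J" for j
      using local_field_mono[of "(\<lambda>y. y + ?x j) ` cube n" ?A2] occurrence_local[of n \<eta> "?x j"] that by blast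
    then have "(\<Union>j\<in>J. occurrence n \<eta> (?x j)) \<in> sets (local_field ?A2)"
      using insert.hyps(1) by (intro sets.finite_UN) auto
    from sets.compl_sets[OF this] have E2: "?E2 \<in> sets (local_field ?A2)" by simp
    have "card ?A1 = (n + 1) ^ CARD('d)"
      by (subst card_image) (auto simp: inj_on_def card_cube)
    with small have "prob ?E1 + real (card ?A1) * (C1 * exp (- C2 * real m)) \<le> 1 - ?p / 2"
      using p1 by simp
    then show ?thesis
      using mixing_bound[OF A _ m E1 E2] assms(2)
      by (meson measure_nonneg mult_right_mono of_nat_0_less_iff order_trans less_le_trans zero_less_one)
  qed
  also have "\<dots> \<le> (1 - ?p / 2) * (1 - ?p / 2) ^ card J"
    using prob_le_1[of "cylinder (cube n) \<eta>"] by (intro mult_left_mono insert.IH) linarith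
  finally show ?case unfolding eq using insert.hyps by simp
qed

text \<open>If the waiting time is long, the pattern is missing at every point of a sublattice
  inside the searched box; the product bound then becomes exponential by 1 - x \<le> exp
  (-x).\<close>

lemma prob_waiting_time_gt:
  assumes "m \<ge> 1"
    and "real ((n + 1) ^ CARD('d)) * (C1 * exp (- C2 * real m)) \<le> prob (cylinder (cube n) \<eta>) / 2"
  shows "prob {\<sigma>. waiting_time n \<eta> \<sigma> > enat ((n + m) * K)} \<le>
    exp (- (prob (cylinder (cube n) \<eta>) / 2) * real K ^ CARD('d))"
proof -
  let ?p = "prob (cylinder (cube n) \<eta>)"
  let ?J = "int_box 1 (int K) :: (int ^ 'd) set"
  have ev: "UNIV - (\<Union>j\<in>?J. occurrence n \<eta> (int (n + m) *s j)) \<in> events"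
    by (metis finite_int_box occurrence_events sets.compl_sets sets.finite_UN space_P)
  have "prob {\<sigma>. waiting_time n \<eta> \<sigma> > enat ((n + m) * K)} \<le> prob (UNIV - (\<Union>j\<in>?J. occurrence n \<eta> (int (n + m) *s j)))"
  proof (rule finite_measure_mono[OF _ ev], safe)
    fix \<sigma> j assume w: "waiting_time n \<eta> \<sigma> > enat ((n + m) * K)" and j: "j \<in> ?J"
      and "\<sigma> \<in> occurrence n \<eta> (int (n + m) *s j)"
    moreover have ji: "1 \<le> j $ i" "j $ i \<le> int K" for i using j by (auto simp: int_box_def)
    have "0 \<le> (int (n + m) *s j) $ i \<and> (int (n + m) *s j) $ i \<le> int ((n + m) * K)" for i
    proof -
      have "int (n + m) * j $ i \<le> int (n + m) * int K"
        using ji(2)[of i] by (intro mult_left_mono) auto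
      moreover have "0 \<le> int (n + m) * j $ i"
        using ji(1)[of i] by (intro mult_nonneg_nonneg) auto
      ultimately show ?thesis by (simp only: vector_smult_component of_nat_mult)
    qed
    moreover have "l1norm (int (n + m) *s j) > 0"
    proof -
      have "int (n + m) * j $ undefined \<noteq> 0"
        using ji(1)[of undefined] assms(1) by (auto simp del: of_nat_add)
      then show ?thesis unfolding l1norm_pos by (metis vector_smult_component)
    qed
    ultimately have "waiting_time n \<eta> \<sigma> \<le> enat ((n + m) * K)"
      unfolding waiting_time_le_iff by blast
    with w show False by simp
  qed simp
  also have "\<dots> \<le> (1 - ?p / 2) ^ card ?J"
    by (rule prob_no_occurrence[OF _ assms]) simp
  also have "\<dots> \<le> exp (- (?p / 2)) ^ card ?J"
    using exp_ge_add_one_self[of "- (?p / 2)"] prob_le_1[of "cylinder (cube n) \<eta>"]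
    by (intro power_mono) (simp, linarith)
  also have "\<dots> = exp (- (?p / 2) * real K ^ CARD('d))"
    by (simp add: exp_of_nat_mult[symmetric] card_int_box mult.commute)
  finally show ?thesis .
qed

lemma hitting_time_waiting_time:
  assumes "m \<ge> 1" "prob (cylinder (cube n) \<eta>) > 0"
    and "real ((n + 1) ^ CARD('d)) * (C1 * exp (- C2 * real m)) \<le> prob (cylinder (cube n) \<eta>) / 2"
  shows "hitting_time P (waiting_time n \<eta>) (prob (cylinder (cube n) \<eta>)) CARD('d) (n + m)"
proof
  show "1 \<le> CARD('d)" by (simp add: Suc_leI)
qed (use assms prob_waiting_time_gt prob_waiting_time_le prob_waiting_time_le_1 in
      \<open>auto simp: waiting_time_ge_1\<close>)

end

section \<open>Moments of the waiting time\<close>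

lemma waiting_time_restrict [simp]: "waiting_time n (restrict \<xi> (cube n)) \<sigma> = waiting_time n \<xi> \<sigma>"
  by (simp add: waiting_time_def)

locale mixing_gibbs_field = gibbs_field U P + mixing_field P C1 C2
  for U :: "('a::finite, 'd::finite) interaction" and P :: "('a, 'd) config measure" and C1 C2 :: real
begin

abbreviation pattern_prob :: "nat \<Rightarrow> ('a, 'd) config \<Rightarrow> real" where
  "pattern_prob n \<eta> \<equiv> prob (cylinder (cube n) \<eta>)"

definition volume :: "nat \<Rightarrow> real" where
  "volume n = real (n + 1) ^ CARD('d)"

lemma card_cube_volume: "real (card (cube n :: (int ^ 'd) set)) = volume n"
  by (simp add: card_cube volume_def)

lemma volume_ge: "real n + 1 \<le> volume n"
proof -
  have "(real n + 1) ^ 1 \<le> (real n + 1) ^ CARD('d)"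
    by (rule power_increasing) (auto simp: Suc_leI)
  then show ?thesis by (simp add: volume_def add.commute)
qed

lemma volume_ge_1: "1 \<le> volume n"
  using volume_ge[of n] by linarith

lemma pattern_prob_pos: "0 < pattern_prob n \<eta>"
proof -
  have "0 < exp (- 2 * boundary_norm U (cube n)) * (exp (- energy U (cube n) \<eta>) / partition_fn U (cube n))"
    using partition_fn_pos[of "cube n" U] by simp
  also have "\<dots> \<le> pattern_prob n \<eta>" by (rule prob_cylinder_bounds) simp
  finally show ?thesis .
qed

lemma ln_pattern_prob:
  "\<bar>ln (pattern_prob n \<eta>) - (- energy U (cube n) \<eta> - ln (partition_fn U (cube n)))\<bar> \<le> 2 * boundary_norm U (cube n)"
proof -
  let ?g = "exp (- energy U (cube n) \<eta>) / partition_fn U (cube n)"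
  have Z: "0 < partition_fn U (cube n)" by (rule partition_fn_pos) simp
  have ln: "ln (exp c * ?g) = c - energy U (cube n) \<eta> - ln (partition_fn U (cube n))" for c
    using Z by (simp add: ln_mult ln_div)
  have "ln (exp (- 2 * boundary_norm U (cube n)) * ?g) \<le> ln (pattern_prob n \<eta>)"
    using prob_cylinder_bounds(1)[OF cube_in_finite_regions, of n \<eta>] Z pattern_prob_pos[of n \<eta>]
    by (subst ln_le_cancel_iff) auto
  moreover have "ln (pattern_prob n \<eta>) \<le> ln (exp (2 * boundary_norm U (cube n)) * ?g)"
    using prob_cylinder_bounds(2)[OF cube_in_finite_regions, of n \<eta>] Z pattern_prob_pos[of n \<eta>]
    by (subst ln_le_cancel_iff) auto
  ultimately show ?thesis unfolding ln by linarith
qed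

text \<open>Cost per site of the logarithm of a pattern probability: 2 \<open>site_norm U\<close>
  for the boundary, 1 for the energy, and 1 plus \<open>ln (real CARD('a))\<close> for the partition
  function.\<close>

definition \<kappa> :: real where "\<kappa> = 4 * site_norm U + ln (real CARD('a))"

lemma \<kappa>_nonneg: "0 \<le> \<kappa>"
  unfolding \<kappa>_def using site_norm_nonneg by (simp add: Suc_leI)

lemma ln_pattern_prob_ge: "- \<kappa> * volume n \<le> ln (pattern_prob n \<eta>)"
proof -
  have "boundary_norm U (cube n) \<le> volume n * site_norm U"
    using boundary_norm_le_card[of "cube n"] by (simp add: card_cube_volume)
  moreover have "\<bar>energy U (cube n) \<eta>\<bar> \<le> volume n * site_norm U"
    using abs_energy_le[of "cube n"] by (simp add: card_cube_volume)
  moreover have "\<bar>ln (partition_fn U (cube n))\<bar> \<le> volume n * (site_norm U + ln (real CARD('a)))"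
    using abs_ln_partition_fn_le[of "cube n"] by (simp add: card_cube_volume)
  moreover have "- \<kappa> * volume n = - (4 * (volume n * site_norm U) + volume n * ln (real CARD('a)))"
    by (simp add: \<kappa>_def algebra_simps)
  ultimately show ?thesis
    using ln_pattern_prob[of n \<eta>] unfolding distrib_left by linarith
qed

text \<open>The factor makes the mixing error \<open>volume n * C1 * exp (- C2 * gap n)\<close> at most half of
  \<open>exp (- \<kappa> * volume n)\<close>, the lower bound on all pattern probabilities.\<close>

definition gap :: "nat \<Rightarrow> nat" where
  "gap n = nat \<lceil>(\<kappa> + 2 * C1) / C2 * volume n\<rceil>"

lemma gap_arg_pos: "0 < (\<kappa> + 2 * C1) / C2 * volume n"
  using \<kappa>_nonneg C1 C2 volume_ge_1[of n] by (intro mult_pos_pos divide_pos_pos) auto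

lemma gap_ge_1: "1 \<le> gap n"
  unfolding gap_def using gap_arg_pos[of n] by linarith

lemma gap_le: "real (n + gap n) \<le> (1 + (\<kappa> + 2 * C1) / C2) * volume n"
proof -
  have "real (gap n) \<le> (\<kappa> + 2 * C1) / C2 * volume n + 1"
    unfolding gap_def using gap_arg_pos[of n] by linarith
  with volume_ge[of n] show ?thesis unfolding distrib_right of_nat_add by linarith
qed

lemma gap_mixing:
  "real ((n + 1) ^ CARD('d)) * (C1 * exp (- C2 * real (gap n))) \<le> pattern_prob n \<eta> / 2"
proof -
  have "(\<kappa> + 2 * C1) / C2 * volume n \<le> real (gap n)"
    unfolding gap_def by linarith
  then have "(\<kappa> + 2 * C1) * volume n \<le> C2 * real (gap n)"
    using C2 by (simp add: field_simps)
  then have "exp (- C2 * real (gap n)) \<le> exp (- \<kappa> * volume n) * exp (- (2 * C1 * volume n))"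
    by (simp add: exp_add[symmetric] algebra_simps)
  then have "volume n * (C1 * exp (- C2 * real (gap n))) \<le> volume n * (C1 * (exp (- \<kappa> * volume n) * exp (- (2 * C1 * volume n))))"
    using C1 volume_ge_1[of n] by (intro mult_left_mono) auto
  \<comment> \<open>The summand \<open>2 * C1\<close> in the gap yields a factor exp (-x) with x = 2
    * C1 * volume n; since x * exp (-x) \<le> 1, it absorbs the prefactor and leaves the
    1/2.\<close>
  also have "\<dots> = exp (- \<kappa> * volume n) * ((2 * C1 * volume n) * exp (- (2 * C1 * volume n))) / 2"
    by simp
  also have "\<dots> \<le> exp (- \<kappa> * volume n) * 1 / 2"
  proof (intro divide_right_mono mult_left_mono)
    have "2 * C1 * volume n \<le> exp (2 * C1 * volume n)"
      using exp_ge_add_one_self[of "2 * C1 * volume n"] by linarith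
    then show "2 * C1 * volume n * exp (- (2 * C1 * volume n)) \<le> 1"
      by (simp add: exp_minus field_simps)
  qed auto
  also have "exp (- \<kappa> * volume n) \<le> exp (ln (pattern_prob n \<eta>))"
    using ln_pattern_prob_ge[of n \<eta>] by simp
  finally show ?thesis
    using pattern_prob_pos[of n \<eta>] by (simp add: volume_def)
qed

definition moment :: "real \<Rightarrow> nat \<Rightarrow> ('a, 'd) config \<Rightarrow> ennreal" where
  "moment q n \<eta> = (\<integral>\<^sup>+ \<sigma>. enat_powr (waiting_time n \<eta> \<sigma>) (q * real CARD('d)) \<partial>P)"

lemma hitting_time_pattern:
  "hitting_time P (waiting_time n \<eta>) (pattern_prob n \<eta>) CARD('d) (n + gap n)"
  by (rule hitting_time_waiting_time[OF gap_ge_1 pattern_prob_pos gap_mixing])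

text \<open>The constants are uniform in the pattern and in n. Powers of the spacing become powers
  of the volume by \<open>gap_le\<close>; the exponent 0 belongs to the bound free of the spacing,
  the exponent 1 to the count of dyadic layers.\<close>

lemma moment_bounds:
  obtains l u b b' where "l > 0" "u > 0"
    "\<And>n \<eta>. ennreal (l * volume n powr b * moment_rate q (pattern_prob n \<eta>)) \<le> moment q n \<eta>"
    "\<And>n \<eta>. moment q n \<eta> \<le> ennreal (u * volume n powr b' * moment_rate q (pattern_prob n \<eta>))"
proof -
  let ?d = "real CARD('d)"
  let ?c = "1 + (\<kappa> + 2 * C1) / C2"
  have c: "0 < ?c" using \<kappa>_nonneg C1 C2 by (intro add_pos_nonneg divide_nonneg_pos) auto
  have rate: "0 \<le> moment_rate q (pattern_prob n \<eta>)" for n \<eta>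
    by (simp add: moment_rate_def)
  have vol: "0 < volume n" for n using volume_ge_1[of n] by linarith
  show ?thesis
  proof (cases "q > 0")
    case True
    define K where "K = (\<Sum>j. (real j + 1) powr (q * ?d) * exp (- real j / 2))"
    have K: "K > 0"
      unfolding K_def by (rule suminf_pos[OF summable_powr_exp]) simp
    have Kc: "0 < K * (2 * ?c) powr (q * ?d)"
      by (intro mult_pos_pos K powr_gt_zero[THEN iffD2] less_imp_neq[THEN not_sym] mult_pos_pos[OF zero_less_numeral c])
    show ?thesis
    proof (rule that[of "2 powr (- (1 + q * ?d + q))" "K * (2 * ?c) powr (q * ?d)" 0 "q * ?d"])
      fix n \<eta>
      interpret H: hitting_time P "waiting_time n \<eta>" "pattern_prob n \<eta>" "CARD('d)" "n + gap n"
        by (rule hitting_time_pattern)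
      show "ennreal (2 powr (- (1 + q * ?d + q)) * volume n powr 0 * moment_rate q (pattern_prob n \<eta>)) \<le> moment q n \<eta>"
        using H.moment_lower_pos[OF True] True vol[of n] by (simp add: moment_def moment_rate_def)
      have "moment q n \<eta> \<le> ennreal (K * (2 * real (n + gap n)) powr (q * ?d) * pattern_prob n \<eta> powr (- q))"
        unfolding K_def moment_def by (rule H.moment_upper_pos[OF True])
      also have "\<dots> \<le> ennreal (K * (2 * ?c) powr (q * ?d) * volume n powr (q * ?d) * moment_rate q (pattern_prob n \<eta>))"
      proof (rule ennreal_leI)
        have "(2 * real (n + gap n)) powr (q * ?d) \<le> (2 * (?c * volume n)) powr (q * ?d)"
          using gap_le[of n] True by (intro powr_mono2) auto
        also have "\<dots> = (2 * ?c) powr (q * ?d) * volume n powr (q * ?d)"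
          by (simp only: powr_mult mult.assoc)
        finally show "K * (2 * real (n + gap n)) powr (q * ?d) * pattern_prob n \<eta> powr (- q)
          \<le> K * (2 * ?c) powr (q * ?d) * volume n powr (q * ?d) * moment_rate q (pattern_prob n \<eta>)"
          using K True unfolding mult.assoc by (intro mult_left_mono) (auto simp: moment_rate_def mult.assoc[symmetric] intro!: mult_right_mono)
      qed
      finally show "moment q n \<eta> \<le> ennreal (K * (2 * ?c) powr (q * ?d) * volume n powr (q * ?d) * moment_rate q (pattern_prob n \<eta>))" .
    qed (simp, rule Kc)
  next
    case False
    then have q: "q \<le> 0" by simp
    have qd: "q * ?d \<le> 0" using q by (simp add: mult_nonpos_nonneg)
    have l0: "0 < 1 / 2 * (4 * ?c) powr (q * ?d)"
      by (intro mult_pos_pos powr_gt_zero[THEN iffD2] less_imp_neq[THEN not_sym] mult_pos_pos[OF zero_less_numeral c]) simp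
    have u0: "0 < 4 ^ CARD('d) * (1 + \<kappa> / ln 2) + 1"
      using \<kappa>_nonneg by (intro add_nonneg_pos mult_nonneg_nonneg add_nonneg_nonneg divide_nonneg_pos) auto
    show ?thesis
    proof (rule that[of "1 / 2 * (4 * ?c) powr (q * ?d)" "4 ^ CARD('d) * (1 + \<kappa> / ln 2) + 1" "q * ?d" 1])
      fix n \<eta>
      interpret H: hitting_time P "waiting_time n \<eta>" "pattern_prob n \<eta>" "CARD('d)" "n + gap n"
        by (rule hitting_time_pattern)
      have "(4 * (?c * volume n)) powr (q * ?d) \<le> (4 * real (n + gap n)) powr (q * ?d)"
        using gap_le[of n] gap_ge_1[of n] qd by (intro powr_mono2') auto
      then have "(4 * ?c) powr (q * ?d) * volume n powr (q * ?d) \<le> (4 * real (n + gap n)) powr (q * ?d)"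
        by (simp only: powr_mult[symmetric] mult.assoc)
      then have "1 / 2 * ((4 * ?c) powr (q * ?d) * volume n powr (q * ?d)) \<le> 1 / 2 * (4 * real (n + gap n)) powr (q * ?d)"
        by (rule mult_left_mono) simp
      then have "1 / 2 * (4 * ?c) powr (q * ?d) * volume n powr (q * ?d) * moment_rate q (pattern_prob n \<eta>)
         \<le> 1 / 2 * (4 * real (n + gap n)) powr (q * ?d) * moment_rate q (pattern_prob n \<eta>)"
        unfolding mult.assoc[of "1 / 2" "(4 * ?c) powr (q * ?d)"] using rate by (rule mult_right_mono)
      then show "ennreal (1 / 2 * (4 * ?c) powr (q * ?d) * volume n powr (q * ?d) * moment_rate q (pattern_prob n \<eta>)) \<le> moment q n \<eta>"
        unfolding moment_def by (rule order_trans[OF ennreal_leI H.moment_lower_nonpos[OF q]])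
      \<comment> \<open>No pattern is rarer than exponential in the volume, so the number of dyadic
        layers is at most linear in it.\<close>
      have "- log 2 (pattern_prob n \<eta>) \<le> \<kappa> / ln 2 * volume n"
        using ln_pattern_prob_ge[of n \<eta>] by (simp add: log_def field_simps)
      then have "4 ^ CARD('d) * (1 - log 2 (pattern_prob n \<eta>)) + 1 \<le> 4 ^ CARD('d) * (1 * volume n + \<kappa> / ln 2 * volume n) + 1 * volume n"
        using volume_ge_1[of n] by (intro add_mono mult_left_mono) auto
      also have "\<dots> = (4 ^ CARD('d) * (1 + \<kappa> / ln 2) + 1) * volume n powr 1"
        using vol[of n] by (simp add: algebra_simps)
      finally have "(4 ^ CARD('d) * (1 - log 2 (pattern_prob n \<eta>)) + 1) * moment_rate q (pattern_prob n \<eta>) \<le>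
          (4 ^ CARD('d) * (1 + \<kappa> / ln 2) + 1) * volume n powr 1 * moment_rate q (pattern_prob n \<eta>)"
        by (rule mult_right_mono) (rule rate)
      then show "moment q n \<eta> \<le> ennreal ((4 ^ CARD('d) * (1 + \<kappa> / ln 2) + 1) * volume n powr 1 * moment_rate q (pattern_prob n \<eta>))"
        unfolding moment_def by (rule order_trans[OF H.moment_upper_nonpos[OF q] ennreal_leI])
    qed (rule l0, rule u0)
  qed
qed

definition patterns :: "nat \<Rightarrow> ('a, 'd) config set" where
  "patterns n = cube n \<rightarrow>\<^sub>E UNIV"

lemma finite_patterns [simp]: "finite (patterns n)"
  unfolding patterns_def by (intro finite_PiE) auto

lemma patterns_nonempty: "patterns n \<noteq> {}"
  by (simp add: patterns_def PiE_eq_empty_iff)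

text \<open>The waiting time depends on \<open>\<xi>\<close> only through its pattern on the cube,
  so integrating over the first factor is a finite sum; the product measure supplies the
  weights.\<close>

lemma integral_waiting_time:
  "(\<integral>\<^sup>+ (\<xi>, \<sigma>). enat_powr (waiting_time n \<xi> \<sigma>) (q * real CARD('d)) \<partial>(P \<Otimes>\<^sub>M P)) =
    (\<Sum>\<eta>\<in>patterns n. ennreal (pattern_prob n \<eta>) * moment q n \<eta>)"
proof -
  let ?f = "\<lambda>\<eta> \<sigma>. enat_powr (waiting_time n \<eta> \<sigma>) (q * real CARD('d))"
  have [measurable]: "?f \<eta> \<in> borel_measurable P" for \<eta>
    by measurable
  have split: "?f \<xi> \<sigma> = (\<Sum>\<eta>\<in>patterns n. indicator (cylinder (cube n) \<eta>) \<xi> * ?f \<eta> \<sigma>)" for \<xi> \<sigma>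
  proof -
    have "(\<Sum>\<eta>\<in>patterns n. indicator (cylinder (cube n) \<eta>) \<xi> * ?f \<eta> \<sigma>) =
      (\<Sum>\<eta>\<in>patterns n. if \<eta> = restrict \<xi> (cube n) then ?f \<eta> \<sigma> else 0)"
      by (intro sum.cong refl) (auto simp: cylinder_def indicator_def patterns_def PiE_restrict)
    also have "\<dots> = ?f (restrict \<xi> (cube n)) \<sigma>"
      by (subst sum.delta) (auto simp: patterns_def intro!: finite_PiE)
    finally show ?thesis by simp
  qed
  have "(\<integral>\<^sup>+ (\<xi>, \<sigma>). ?f \<xi> \<sigma> \<partial>(P \<Otimes>\<^sub>M P)) =
    (\<integral>\<^sup>+ z. (\<Sum>\<eta>\<in>patterns n. indicator (cylinder (cube n) \<eta>) (fst z) * ?f \<eta> (snd z)) \<partial>(P \<Otimes>\<^sub>M P))"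
    by (intro nn_integral_cong) (simp only: split_beta split[symmetric])
  also have "\<dots> = (\<Sum>\<eta>\<in>patterns n. \<integral>\<^sup>+ z. indicator (cylinder (cube n) \<eta>) (fst z) * ?f \<eta> (snd z) \<partial>(P \<Otimes>\<^sub>M P))"
    by (rule nn_integral_sum) measurable
  also have "\<dots> = (\<Sum>\<eta>\<in>patterns n. ennreal (pattern_prob n \<eta>) * moment q n \<eta>)"
  proof (rule sum.cong[OF refl])
    fix \<eta>
    have "(\<integral>\<^sup>+ z. indicator (cylinder (cube n) \<eta>) (fst z) * ?f \<eta> (snd z) \<partial>(P \<Otimes>\<^sub>M P)) =
      (\<integral>\<^sup>+ x. \<integral>\<^sup>+ y. indicator (cylinder (cube n) \<eta>) x * ?f \<eta> y \<partial>P \<partial>P)"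
      by (subst nn_integral_fst[symmetric]) (simp_all, measurable)
    also have "\<dots> = (\<integral>\<^sup>+ x. indicator (cylinder (cube n) \<eta>) x * moment q n \<eta> \<partial>P)"
      unfolding moment_def by (intro nn_integral_cong nn_integral_cmult) measurable
    also have "\<dots> = ennreal (pattern_prob n \<eta>) * moment q n \<eta>"
      by (subst nn_integral_multc) (auto simp: emeasure_eq_measure)
    finally show "(\<integral>\<^sup>+ z. indicator (cylinder (cube n) \<eta>) (fst z) * ?f \<eta> (snd z) \<partial>(P \<Otimes>\<^sub>M P)) =
      ennreal (pattern_prob n \<eta>) * moment q n \<eta>" .
  qed
  finally show ?thesis .
qed

text \<open>Up to boundary terms each probability is exp (- E) / Z; raising to the power
  \<open>r\<close> scales the interaction and divides by Z^r, which gives the two partition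
  functions.\<close>

lemma ln_sum_pattern_prob_powr:
  "\<bar>ln (\<Sum>\<eta>\<in>patterns n. pattern_prob n \<eta> powr r) -
     (ln (partition_fn (\<lambda>A \<sigma>. r * U A \<sigma>) (cube n)) - r * ln (partition_fn U (cube n)))\<bar>
   \<le> 2 * \<bar>r\<bar> * boundary_norm U (cube n)"
proof -
  let ?Z = "partition_fn U (cube n)"
  let ?E = "energy U (cube n)"
  have "(\<Sum>\<eta>\<in>patterns n. exp (- r * ?E \<eta> - r * ln ?Z)) =
      partition_fn (\<lambda>A \<sigma>. r * U A \<sigma>) (cube n) * exp (- r * ln ?Z)"
    unfolding partition_fn_scale patterns_def sum_distrib_right
    by (simp add: exp_add[symmetric])
  then have "ln (\<Sum>\<eta>\<in>patterns n. exp (- r * ?E \<eta> - r * ln ?Z)) =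
      ln (partition_fn (\<lambda>A \<sigma>. r * U A \<sigma>) (cube n)) - r * ln ?Z"
    using partition_fn_pos[of "cube n" "\<lambda>A \<sigma>. r * U A \<sigma>"] by (simp add: ln_mult)
  moreover have "(\<Sum>\<eta>\<in>patterns n. pattern_prob n \<eta> powr r) = (\<Sum>\<eta>\<in>patterns n. exp (r * ln (pattern_prob n \<eta>)))"
    by (intro sum.cong refl) (simp add: powr_def pattern_prob_pos[THEN less_imp_neq, THEN not_sym])
  moreover have "\<bar>ln (\<Sum>\<eta>\<in>patterns n. exp (r * ln (pattern_prob n \<eta>))) -
     ln (\<Sum>\<eta>\<in>patterns n. exp (- r * ?E \<eta> - r * ln ?Z))\<bar> \<le> 2 * \<bar>r\<bar> * boundary_norm U (cube n)"
  proof (rule ln_sum_exp_diff_le[OF finite_patterns patterns_nonempty])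
    fix \<eta>
    have "r * ln (pattern_prob n \<eta>) - (- r * ?E \<eta> - r * ln ?Z) = r * (ln (pattern_prob n \<eta>) - (- ?E \<eta> - ln ?Z))"
      by (simp add: algebra_simps)
    then show "\<bar>r * ln (pattern_prob n \<eta>) - (- r * ?E \<eta> - r * ln ?Z)\<bar> \<le> 2 * \<bar>r\<bar> * boundary_norm U (cube n)"
      using mult_left_mono[OF ln_pattern_prob[of n \<eta>], of "\<bar>r\<bar>"] by (simp add: abs_mult mult_ac)
  qed
  ultimately show ?thesis by simp
qed

section \<open>Normalised error terms and the limit\<close>

lemma inverse_volume_tendsto: "(\<lambda>n. 1 / real n ^ CARD('d)) \<longlonglongrightarrow> 0"
proof (rule tendsto_sandwich[where f = "\<lambda>_. 0" and h = "\<lambda>n. 1 / real n"])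
  show "(\<lambda>n. 1 / real n) \<longlonglongrightarrow> 0" by real_asymp
  show "\<forall>\<^sub>F n in sequentially. 1 / real n ^ CARD('d) \<le> 1 / real n"
    using eventually_gt_at_top[of 0]
  proof eventually_elim
    case (elim n)
    have "real n ^ 1 \<le> real n ^ CARD('d)"
      using elim by (intro power_increasing) (auto simp: Suc_leI)
    then show ?case using elim by (simp add: frac_le)
  qed
qed auto

lemma ln_volume_tendsto: "(\<lambda>n. ln (volume n) / real n ^ CARD('d)) \<longlonglongrightarrow> 0"
proof (rule tendsto_sandwich[where f = "\<lambda>_. 0" and h = "\<lambda>n. real CARD('d) * (ln (real n + 1) / real n)"])
  have "(\<lambda>n. ln (real n + 1) / real n) \<longlonglongrightarrow> 0" by real_asymp
  then show "(\<lambda>n. real CARD('d) * (ln (real n + 1) / real n)) \<longlonglongrightarrow> 0"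
    using tendsto_mult_right_zero by blast
  show "\<forall>\<^sub>F n in sequentially. ln (volume n) / real n ^ CARD('d) \<le> real CARD('d) * (ln (real n + 1) / real n)"
    using eventually_gt_at_top[of 0]
  proof eventually_elim
    case (elim n)
    have "real n ^ 1 \<le> real n ^ CARD('d)"
      using elim by (intro power_increasing) (auto simp: Suc_leI)
    moreover have "0 \<le> ln (volume n)" using volume_ge_1 by (rule ln_ge_zero)
    ultimately have "ln (volume n) / real n ^ CARD('d) \<le> ln (volume n) / real n"
      using elim by (intro divide_left_mono) auto
    also have "\<dots> = real CARD('d) * (ln (real n + 1) / real n)"
      by (simp add: volume_def ln_realpow add.commute)
    finally show ?case .
  qed
  show "\<forall>\<^sub>F n in sequentially. 0 \<le> ln (volume n) / real n ^ CARD('d)"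
    using volume_ge_1 by (intro always_eventually allI divide_nonneg_nonneg ln_ge_zero) auto
qed auto

lemma boundary_tendsto: "(\<lambda>n. boundary_norm U (cube n) / real n ^ CARD('d)) \<longlonglongrightarrow> 0"
proof -
  have "(\<lambda>n. (real n + 1) / real n) \<longlonglongrightarrow> 1" by real_asymp
  then have "(\<lambda>n. ((real n + 1) / real n) ^ CARD('d)) \<longlonglongrightarrow> 1 ^ CARD('d)" by (intro tendsto_intros)
  from tendsto_mult[OF boundary_norm_tendsto this] show ?thesis
    by (simp add: power_divide add.commute)
qed

text \<open>The two moment bounds share one rate, so the integral lies between polynomial multiples
  of the same power sum of pattern probabilities; these multiples disappear after taking logarithms
  and dividing by n^d.\<close>

lemma waiting_time_spectrum:
  fixes q :: real
  defines "r \<equiv> (if q \<ge> -1 then 1 - q else 2)"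
  shows "(\<lambda>n. ereal (1 / real n ^ CARD('d)) *
      ln_ennreal (\<integral>\<^sup>+ (\<xi>, \<sigma>). enat_powr (waiting_time n \<xi> \<sigma>) (q * real CARD('d)) \<partial>(P \<Otimes>\<^sub>M P)))
    \<longlonglongrightarrow> ereal (pressure (\<lambda>A \<sigma>. r * U A \<sigma>) - r * pressure U)"
proof -
  interpret R: summable_interaction "\<lambda>A \<sigma>. r * U A \<sigma>" by (rule summable_interaction_scale)
  let ?I = "\<lambda>n. \<integral>\<^sup>+ (\<xi>, \<sigma>). enat_powr (waiting_time n \<xi> \<sigma>) (q * real CARD('d)) \<partial>(P \<Otimes>\<^sub>M P)"
  define S where "S n = (\<Sum>\<eta>\<in>patterns n. pattern_prob n \<eta> powr r)" for n
  define F where "F n = ln (partition_fn (\<lambda>A \<sigma>. r * U A \<sigma>) (cube n)) - r * ln (partition_fn U (cube n))" for n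
  have S: "0 < S n" for n
    unfolding S_def by (rule sum_pos) (use pattern_prob_pos in \<open>auto simp: patterns_nonempty less_imp_neq[THEN not_sym]\<close>)
  \<comment> \<open>Origin of \<open>r\<close>: the weight of the pattern adds one power of its
    probability to the rate, giving 1 - q in one case and 2 in the other.\<close>
  have rate: "pattern_prob n \<eta> * moment_rate q (pattern_prob n \<eta>) = pattern_prob n \<eta> powr r" for n \<eta>
    using pattern_prob_pos[of n \<eta>]
    by (auto simp: moment_rate_def r_def powr_diff powr_minus field_simps power2_eq_square)
  obtain l u b b' where lu: "l > 0" "u > 0"
    and lower: "\<And>n \<eta>. ennreal (l * volume n powr b * moment_rate q (pattern_prob n \<eta>)) \<le> moment q n \<eta>"
    and upper: "\<And>n \<eta>. moment q n \<eta> \<le> ennreal (u * volume n powr b' * moment_rate q (pattern_prob n \<eta>))"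
    by (rule moment_bounds[of q]) (rule that)
  have sum_eq: "(\<Sum>\<eta>\<in>patterns n. ennreal (pattern_prob n \<eta>) * ennreal (c * moment_rate q (pattern_prob n \<eta>))) = ennreal (c * S n)"
    if "0 \<le> c" for n c
  proof -
    have "ennreal (pattern_prob n \<eta>) * ennreal (c * moment_rate q (pattern_prob n \<eta>)) = ennreal (c * pattern_prob n \<eta> powr r)" for \<eta>
      using that by (simp add: rate[symmetric] ennreal_mult'[symmetric] mult.left_commute)
    then show ?thesis
      using that by (simp add: S_def sum_distrib_left sum_ennreal)
  qed
  have vol: "0 < volume n" for n using volume_ge_1[of n] by linarith
  have low: "ennreal (l * volume n powr b * S n) \<le> ?I n" for n
    unfolding integral_waiting_time using lu lower
    by (subst sum_eq[symmetric]) (auto intro!: sum_mono mult_left_mono)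
  have up: "?I n \<le> ennreal (u * volume n powr b' * S n)" for n
    unfolding integral_waiting_time using lu upper
    by (subst sum_eq[symmetric]) (auto intro!: sum_mono mult_left_mono)
  \<comment> \<open>The upper bound makes the integral finite and the lower one makes it positive,
    so the infinite values of \<open>ln_ennreal\<close> do not occur.\<close>
  define i where "i n = enn2real (?I n)" for n
  have fin: "?I n = ennreal (i n)" for n
    unfolding i_def by (rule ennreal_enn2real[OF le_less_trans[OF up ennreal_less_top], symmetric])
  have i0: "0 \<le> i n" for n by (simp add: i_def)
  have i_low: "l * volume n powr b * S n \<le> i n" for n
    using low[of n] i0[of n] unfolding fin[of n] by (subst (asm) ennreal_le_iff)
  have i_up: "i n \<le> u * volume n powr b' * S n" for n
    using up[of n] lu(2) S[of n] unfolding fin[of n] by (subst (asm) ennreal_le_iff) auto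
  have pos: "0 < l * volume n powr b * S n" for n
    using lu S[of n] vol[of n] by simp
  have ipos: "0 < i n" for n using pos i_low by (rule less_le_trans)
  have ln_eq: "ln (c * volume n powr a * S n) = ln c + a * ln (volume n) + ln (S n)" if "c > 0" for c a n
    using that S[of n] vol[of n] by (simp add: ln_mult ln_powr)
  have lnS: "\<bar>ln (S n) - F n\<bar> \<le> 2 * \<bar>r\<bar> * boundary_norm U (cube n)" for n
    unfolding S_def F_def by (rule ln_sum_pattern_prob_powr)
  \<comment> \<open>Common form of the logarithms of both bounds: a constant, a power of the volume,
    the main term and a boundary error. The limit does not depend on \<open>c\<close>,
    \<open>a\<close> and \<open>e\<close>.\<close>
  define G where "G c a e n = (ln c + a * ln (volume n) + F n + e * boundary_norm U (cube n)) / real n ^ CARD('d)" for c a e n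
  have G_lim: "G c a e \<longlonglongrightarrow> pressure (\<lambda>A \<sigma>. r * U A \<sigma>) - r * pressure U" for c a e
  proof -
    have "(\<lambda>n. ln c * (1 / real n ^ CARD('d)) + a * (ln (volume n) / real n ^ CARD('d))
        + (ln (partition_fn (\<lambda>A \<sigma>. r * U A \<sigma>) (cube n)) / real n ^ CARD('d) - r * (ln (partition_fn U (cube n)) / real n ^ CARD('d)))
        + e * (boundary_norm U (cube n) / real n ^ CARD('d)))
      \<longlonglongrightarrow> ln c * 0 + a * 0 + (pressure (\<lambda>A \<sigma>. r * U A \<sigma>) - r * pressure U) + e * 0"
      by (intro tendsto_add tendsto_diff tendsto_mult tendsto_const inverse_volume_tendsto ln_volume_tendsto
          boundary_tendsto pressure_tendsto R.pressure_tendsto)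
    then show ?thesis
      unfolding G_def F_def by (simp add: add_divide_distrib diff_divide_distrib)
  qed
  have "(\<lambda>n. ln (i n) / real n ^ CARD('d)) \<longlonglongrightarrow> pressure (\<lambda>A \<sigma>. r * U A \<sigma>) - r * pressure U"
  proof (rule tendsto_sandwich[OF _ _ G_lim[of l b "- (2 * \<bar>r\<bar>)"] G_lim[of u b' "2 * \<bar>r\<bar>"]])
    show "\<forall>\<^sub>F n in sequentially. G l b (- (2 * \<bar>r\<bar>)) n \<le> ln (i n) / real n ^ CARD('d)"
    proof (intro always_eventually allI)
      fix n
      have "ln (l * volume n powr b * S n) \<le> ln (i n)"
        using pos[of n] ipos[of n] i_low[of n] by (subst ln_le_cancel_iff)
      then have "ln l + b * ln (volume n) + F n + - (2 * \<bar>r\<bar>) * boundary_norm U (cube n) \<le> ln (i n)"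
        using lnS[of n] unfolding ln_eq[OF lu(1)] by linarith
      then show "G l b (- (2 * \<bar>r\<bar>)) n \<le> ln (i n) / real n ^ CARD('d)"
        unfolding G_def by (rule divide_right_mono) simp
    qed
    show "\<forall>\<^sub>F n in sequentially. ln (i n) / real n ^ CARD('d) \<le> G u b' (2 * \<bar>r\<bar>) n"
    proof (intro always_eventually allI)
      fix n
      have "ln (i n) \<le> ln (u * volume n powr b' * S n)"
        using ipos[of n] i_up[of n] by (subst ln_le_cancel_iff) auto
      then have "ln (i n) \<le> ln u + b' * ln (volume n) + F n + 2 * \<bar>r\<bar> * boundary_norm U (cube n)"
        using lnS[of n] unfolding ln_eq[OF lu(2)] by linarith
      then show "ln (i n) / real n ^ CARD('d) \<le> G u b' (2 * \<bar>r\<bar>) n"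
        unfolding G_def by (rule divide_right_mono) simp
    qed
  qed
  moreover have "ln_ennreal (?I n) = ereal (ln (i n))" for n
    unfolding fin ln_ennreal_def using ipos[of n] by (simp add: ennreal_eq_0_iff)
  ultimately show ?thesis by simp
qed

end

theorem theorem7:
  fixes U :: "('a::finite, 'd::finite) interaction"
    and P :: "('a, 'd) config measure"
  assumes "CARD('d) \<ge> 2"
    and "translation_invariant_interaction U"
    and "translation_invariant_gibbs_field U P"
    and "nonuniformly_exp_phi_mixing P"
  shows "\<exists>W :: real \<Rightarrow> real. \<forall>q.
    (\<lambda>n. ereal (1 / real n ^ CARD('d)) *
          ln_ennreal (\<integral>\<^sup>+ (\<xi>, \<sigma>). enat_powr (waiting_time n \<xi> \<sigma>) (q * real CARD('d)) \<partial>(P \<Otimes>\<^sub>M P)))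
      \<longlonglongrightarrow> ereal (W q) \<and>
    W q = (if q \<ge> -1
           then pressure (\<lambda>A \<sigma>. (1 - q) * U A \<sigma>) + (q - 1) * pressure U
           else pressure (\<lambda>A \<sigma>. 2 * U A \<sigma>) - 2 * pressure U)"
proof -
  obtain C1 C2 where C: "C1 > 0" "C2 > 0" "\<And>m. m > 0 \<Longrightarrow> phi_mix P m \<le> C1 * exp (- C2 * m)"
    using assms(4) unfolding nonuniformly_exp_phi_mixing_def by blast
  interpret gibbs_field U P by (rule gibbs_field_of_gibbs[OF assms(2,3)])
  interpret mixing_gibbs_field U P C1 C2 by unfold_locales (use C in auto)
  \<comment> \<open>A single exponent covers both branches; the coefficient \<open>- r q\<close> of
    \<open>pressure U\<close> is q - 1 or -2.\<close>
  define r where "r q = (if q \<ge> -1 then 1 - q else 2)" for q :: real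
  show ?thesis
  proof (intro exI[of _ "\<lambda>q. pressure (\<lambda>A \<sigma>. r q * U A \<sigma>) - r q * pressure U"] allI conjI)
    fix q :: real
    show "(\<lambda>n. ereal (1 / real n ^ CARD('d)) *
          ln_ennreal (\<integral>\<^sup>+ (\<xi>, \<sigma>). enat_powr (waiting_time n \<xi> \<sigma>) (q * real CARD('d)) \<partial>(P \<Otimes>\<^sub>M P)))
      \<longlonglongrightarrow> ereal (pressure (\<lambda>A \<sigma>. r q * U A \<sigma>) - r q * pressure U)"
      unfolding r_def by (rule waiting_time_spectrum)
    show "pressure (\<lambda>A \<sigma>. r q * U A \<sigma>) - r q * pressure U = (if q \<ge> -1
           then pressure (\<lambda>A \<sigma>. (1 - q) * U A \<sigma>) + (q - 1) * pressure U
           else pressure (\<lambda>A \<sigma>. 2 * U A \<sigma>) - 2 * pressure U)"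
      by (simp add: r_def algebra_simps)
  qed
qed

end
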